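(* Let $\mathsf{E}_8\subset\mathbb{R}^8$ be the set of the 240 vectors $$\mathsf{E}_8=\{\pm e_i\pm e_j \mid 1\le i<j\le 8\}\cup\left\{\left(\pm\tfrac12,\ldots,\pm\tfrac12\right)\ \middle|\ \text{an even number of minus signs}\right\},$$ and let $\mathsf{E}_7=\{a\in\mathsf{E}_8\mid a_7=a_8\}$. Let $T=\{y\in\mathbb{C}^8\mid y_7=y_8\}$ and let $R=\mathbb{C}[Y_1,\ldots,Y_8]/(Y_7-Y_8)\cong\mathbb{C}[Y_1,\ldots,Y_7]$ be the ring of polynomial functions on $T$. For $b\in\mathsf{E}_8$ let $C_b\in R$ be the restriction to $T$ of the polynomial $(b\cdot Y-1)(b\cdot Y)(b\cdot Y+1)$, and let $\mathrm{Nm}\in R$ be the restriction to $T$ of $\sum_{i=1}^8Y_i^2-2$. Let $I\subseteq R$ be the ideal generated by $\mathrm{Nm}$ and the 56 cubics $C_b$ with $b\in\mathsf{E}_8$, $b_7-b_8=1$. Then: (i) $\mathcal{Z}(I)=\mathsf{E}_7$ (zero set in $T$); (ii) $I$ is a radical ideal; (iii) the smallest degree of a non-trivial polynomial in $\mathcal{I}(\mathsf{E}_7)$ is three; (iv) $\mathcal{I}(\mathsf{E}_7)$ is generated by a set of polynomials all having degree three or less.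
   Context: $e_1,\ldots,e_8$ is the standard basis of $\mathbb{R}^8$, and $b\cdot Y=b_1Y_1+\cdots+b_8Y_8$. $\mathsf{E}_7$ is the set of shortest vectors of the $E_7$ root lattice, spanning the real hyperplane $y_7=y_8$. Here $\mathcal{I}(\mathsf{E}_7)$ is the ideal of all elements of $R$ vanishing at every point of $\mathsf{E}_7$, and $\mathcal{Z}(I)$ is the set of all points of $T$ at which every element of $I$ vanishes. Degree means total degree of a polynomial function on the 7-dimensional space $T$, i.e. total degree in $\mathbb{C}[Y_1,\ldots,Y_7]$ after the substitution $Y_8=Y_7$. An element of $R$ is trivial if it is divisible by $\mathrm{Nm}$ in $R$, and non-trivial otherwise. *)

theory Defs
  imports
    "HOL-Analysis.Finite_Cartesian_Product"
    "HOL-Algebra.Algebraic_Closure_Type"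
    "HOL-Algebra.Divisibility"
    "HOL-Algebra.QuotRing"
    "HOL-Library.Poly_Mapping"
    "HOL-Library.Numeral_Type"
begin

no_notation fps_nth (infixl \<open>$\<close> 75)

(* The coordinates are indexed by the eight-element type 8, whose elements are written
   1, 2, ..., 8.  Arithmetic there is modulo 8, so the index 8 is the same element as 0;
   in particular the order of this type puts 8 first and is never used below. *)

section \<open>The root systems\<close>

definition E8 :: "(real^8) set" where
  "E8 = {axis i s + axis j t | i j s t. i \<noteq> j \<and> s \<in> {1, -1} \<and> t \<in> {1, -1}}
      \<union> {v. (\<forall>i. v $ i \<in> {1/2, -1/2}) \<and> even (card {i. v $ i < 0})}"

definition E7 :: "(real^8) set" where
  "E7 = {a \<in> E8. a $ 7 = a $ 8}"

definition complexify :: "real^8 \<Rightarrow> complex^8" where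
  "complexify a = (\<chi> i. complex_of_real (a $ i))"

definition T_space :: "(complex^8) set" where
  "T_space = {y. y $ 7 = y $ 8}"


section \<open>Polynomials in eight variables\<close>

(* A polynomial is a finitely supported map from exponent vectors to coefficients;
   the multiplication of Poly_Mapping is the convolution product. *)
type_synonym poly8 = "(8 \<Rightarrow>\<^sub>0 nat) \<Rightarrow>\<^sub>0 complex"

definition Const :: "complex \<Rightarrow> poly8" where
  "Const c = Poly_Mapping.single 0 c"

definition Var :: "8 \<Rightarrow> poly8" where
  "Var i = Poly_Mapping.single (Poly_Mapping.single i 1) 1"

(* The value at x of the polynomial whose coefficients are mapped through h. *)
definition poly_subst :: "(complex \<Rightarrow> 'b::comm_ring_1) \<Rightarrow> (8 \<Rightarrow> 'b) \<Rightarrow> poly8 \<Rightarrow> 'b" where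
  "poly_subst h x p =
     (\<Sum>m\<in>Poly_Mapping.keys p.
        h (Poly_Mapping.lookup p m) * (\<Prod>i\<in>UNIV. x i ^ Poly_Mapping.lookup m i))"

definition poly_eval :: "complex^8 \<Rightarrow> poly8 \<Rightarrow> complex" where
  "poly_eval y p = poly_subst (\<lambda>c. c) (\<lambda>i. y $ i) p"

(* The result lies in the subring C[Y_1,...,Y_7] of polynomials not involving Y_8. *)
definition subst_Y8_Y7 :: "poly8 \<Rightarrow> poly8" where
  "subst_Y8_Y7 p = poly_subst Const (\<lambda>i. if i = 8 then Var 7 else Var i) p"

(* The zero polynomial gets degree 0. *)
definition total_degree :: "poly8 \<Rightarrow> nat" where
  "total_degree p =
     Max (insert 0 ((\<lambda>m. \<Sum>i\<in>UNIV. Poly_Mapping.lookup m i) ` Poly_Mapping.keys p))"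


section \<open>The ring of polynomial functions on the hyperplane\<close>

definition P8 :: "poly8 ring" where
  "P8 = ring_of_type_algebra"

definition KT :: "poly8 set" where
  "KT = Idl\<^bsub>P8\<^esub> {Var 7 - Var 8}"

(* Elements of R_T are cosets of KT. *)
definition R_T :: "poly8 set ring" where
  "R_T = P8 Quot KT"

definition restr :: "poly8 \<Rightarrow> poly8 set" where
  "restr p = KT +>\<^bsub>P8\<^esub> p"

(* Value and degree do not depend on the representative of the coset:
   see value_restr and degree_restr below. *)
definition value_at :: "poly8 set \<Rightarrow> complex^8 \<Rightarrow> complex" where
  "value_at f y = the_elem (poly_eval y ` f)"

definition degree_T :: "poly8 set \<Rightarrow> nat" where
  "degree_T f = the_elem ((\<lambda>p. total_degree (subst_Y8_Y7 p)) ` f)"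

definition zero_set :: "poly8 set set \<Rightarrow> (complex^8) set" where
  "zero_set J = {y \<in> T_space. \<forall>f\<in>J. value_at f y = 0}"

definition vanishing_ideal :: "(complex^8) set \<Rightarrow> poly8 set set" where
  "vanishing_ideal S = {f \<in> carrier R_T. \<forall>y\<in>S. value_at f y = 0}"

definition radical_ideal :: "('a, 'b) ring_scheme \<Rightarrow> 'a set \<Rightarrow> bool" where
  "radical_ideal A J \<longleftrightarrow> ideal J A \<and>
     (\<forall>a\<in>carrier A. \<forall>n::nat. a [^]\<^bsub>A\<^esub> n \<in> J \<longrightarrow> a \<in> J)"


section \<open>The generators\<close>

definition lin :: "real^8 \<Rightarrow> poly8" where
  "lin b = (\<Sum>i\<in>UNIV. Const (complex_of_real (b $ i)) * Var i)"

definition cubic :: "real^8 \<Rightarrow> poly8 set" where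
  "cubic b = restr ((lin b - 1) * lin b * (lin b + 1))"

definition Nm :: "poly8 set" where
  "Nm = restr ((\<Sum>i\<in>UNIV. Var i ^ 2) - 2)"

definition I_gen :: "poly8 set set" where
  "I_gen = Idl\<^bsub>R_T\<^esub> (insert Nm {cubic b | b. b \<in> E8 \<and> b $ 7 - b $ 8 = 1})"

definition trivial_elem :: "poly8 set \<Rightarrow> bool" where
  "trivial_elem f \<longleftrightarrow> Nm divides\<^bsub>R_T\<^esub> f"


section \<open>Independence of representatives\<close>

lemma poly_subst_superset:
  assumes "finite A" "Poly_Mapping.keys p \<subseteq> A" "h 0 = 0"
  shows "poly_subst h x p =
     (\<Sum>m\<in>A. h (Poly_Mapping.lookup p m) * (\<Prod>i\<in>UNIV. x i ^ Poly_Mapping.lookup m i))"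
  unfolding poly_subst_def
  by (rule sum.mono_neutral_left) (use assms in \<open>auto simp: in_keys_iff\<close>)

lemma poly_subst_add:
  assumes "h 0 = 0" "\<And>a b. h (a + b) = h a + h b"
  shows "poly_subst h x (p + q) = poly_subst h x p + poly_subst h x q"
proof -
  define A where "A = Poly_Mapping.keys p \<union> Poly_Mapping.keys q"
  have "finite A" "Poly_Mapping.keys p \<subseteq> A" "Poly_Mapping.keys q \<subseteq> A"
    "Poly_Mapping.keys (p + q) \<subseteq> A"
    using Poly_Mapping.keys_add[of p q] by (auto simp: A_def)
  then show ?thesis
    by (simp add: poly_subst_superset[OF \<open>finite A\<close>] assms lookup_add
        sum.distrib distrib_right)
qed

lemma poly_subst_single:
  assumes "h 0 = 0"
  shows "poly_subst h x (Poly_Mapping.single m c) =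
     h c * (\<Prod>i\<in>UNIV. x i ^ Poly_Mapping.lookup m i)"
  using assms by (auto simp: poly_subst_def)

lemma poly_subst_sum:
  assumes "h 0 = 0" "\<And>a b. h (a + b) = h a + h b"
  shows "poly_subst h x (\<Sum>a\<in>A. f a) = (\<Sum>a\<in>A. poly_subst h x (f a))"
  by (induction A rule: infinite_finite_induct)
     (auto simp: poly_subst_add[OF assms], auto simp: poly_subst_def)

lemma poly8_expansion:
  "(p::poly8) = (\<Sum>m\<in>Poly_Mapping.keys p. Poly_Mapping.single m (Poly_Mapping.lookup p m))"
proof (rule poly_mapping_eqI)
  fix k
  show "Poly_Mapping.lookup p k =
    Poly_Mapping.lookup (\<Sum>m\<in>Poly_Mapping.keys p.
      Poly_Mapping.single m (Poly_Mapping.lookup p m)) k"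
    by (cases "k \<in> Poly_Mapping.keys p")
       (auto simp: lookup_sum lookup_single when_def in_keys_iff sum.delta)
qed

lemma poly_subst_mult:
  assumes h: "h 0 = 0" "\<And>a b. h (a + b) = h a + h b" "\<And>a b. h (a * b) = h a * h b"
  shows "poly_subst h x (p * q) = poly_subst h x p * poly_subst h x q"
proof -
  let ?p = "\<lambda>m. Poly_Mapping.single m (Poly_Mapping.lookup p m)"
  let ?q = "\<lambda>m. Poly_Mapping.single m (Poly_Mapping.lookup q m)"
  have "p * q = (\<Sum>m\<in>Poly_Mapping.keys p. ?p m) * (\<Sum>n\<in>Poly_Mapping.keys q. ?q n)"
    by (rule arg_cong2[where f = "(*)", OF poly8_expansion poly8_expansion])
  then have "p * q = (\<Sum>m\<in>Poly_Mapping.keys p. \<Sum>n\<in>Poly_Mapping.keys q. ?p m * ?q n)"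
    by (simp only: sum_product)
  then have "poly_subst h x (p * q) =
      (\<Sum>m\<in>Poly_Mapping.keys p. \<Sum>n\<in>Poly_Mapping.keys q. poly_subst h x (?p m * ?q n))"
    by (simp add: poly_subst_sum[OF h(1,2)])
  also have "\<dots> = poly_subst h x p * poly_subst h x q"
    by (simp add: mult_single poly_subst_single h lookup_add power_add prod.distrib
        poly_subst_def[of h x p] poly_subst_def[of h x q] sum_product ac_simps)
  finally show ?thesis .
qed

lemma Const_hom:
  "Const 0 = 0" "Const (a + b) = Const a + Const b" "Const (a * b) = Const a * Const b"
  by (simp_all add: Const_def single_add mult_single)

lemma poly_eval_add: "poly_eval y (p + q) = poly_eval y p + poly_eval y q"
  and poly_eval_mult: "poly_eval y (p * q) = poly_eval y p * poly_eval y q"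
  by (simp_all add: poly_eval_def poly_subst_add poly_subst_mult)

lemma subst_Y8_Y7_add: "subst_Y8_Y7 (p + q) = subst_Y8_Y7 p + subst_Y8_Y7 q"
  and subst_Y8_Y7_mult: "subst_Y8_Y7 (p * q) = subst_Y8_Y7 p * subst_Y8_Y7 q"
  by (simp_all add: subst_Y8_Y7_def poly_subst_add poly_subst_mult Const_hom)

lemma poly_subst_Var:
  assumes "h 0 = 0" "h 1 = 1"
  shows "poly_subst h x (Var i) = x i"
proof -
  have "(\<Prod>j\<in>UNIV. x j ^ Poly_Mapping.lookup (Poly_Mapping.single i (1::nat)) j)
      = (\<Prod>j\<in>UNIV. if i = j then x j else 1)"
    by (intro prod.cong) (auto simp: lookup_single when_def)
  then show ?thesis
    using assms by (simp add: Var_def poly_subst_single prod.delta')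
qed

lemma poly_eval_Var: "poly_eval y (Var i) = y $ i"
  by (simp add: poly_eval_def poly_subst_Var)

lemma subst_Y8_Y7_Var: "subst_Y8_Y7 (Var i) = (if i = 8 then Var 7 else Var i)"
  unfolding subst_Y8_Y7_def by (subst poly_subst_Var) (auto simp: Const_def)

lemma P8_sel: "carrier P8 = UNIV" "x \<otimes>\<^bsub>P8\<^esub> y = x * y" "x \<oplus>\<^bsub>P8\<^esub> y = x + y"
    "\<one>\<^bsub>P8\<^esub> = 1" "\<zero>\<^bsub>P8\<^esub> = 0"
  by (simp_all add: P8_def ring_of_type_algebra_def)

lemma cring_P8: "cring P8"
  unfolding P8_def by (rule cring_from_type_algebra)

lemma KT_eq: "KT = {q * (Var 7 - Var 8) | q. True}"
  using cring.cgenideal_eq_genideal[OF cring_P8, of "Var 7 - Var 8"]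
  by (simp add: KT_def cgenideal_def P8_sel)

lemma restr_eq: "restr p = {q * (Var 7 - Var 8) + p | q. True}"
  by (auto simp: restr_def a_r_coset_def r_coset_def KT_eq P8_def ring_of_type_algebra_def)

lemma value_restr:
  assumes "y \<in> T_space"
  shows "value_at (restr p) y = poly_eval y p"
proof -
  have "poly_eval y (Var 7 - Var 8) = 0"
    using poly_eval_add[of y "Var 7 - Var 8" "Var 8"] assms by (simp add: poly_eval_Var T_space_def)
  then have "poly_eval y ` restr p = {poly_eval y p}"
    by (auto simp: restr_eq poly_eval_add poly_eval_mult image_iff)
  then show ?thesis by (simp add: value_at_def)
qed

lemma degree_restr: "degree_T (restr p) = total_degree (subst_Y8_Y7 p)"
proof -
  have "(7::8) \<noteq> 8" by simp
  then have "subst_Y8_Y7 (Var 7 - Var 8) = 0"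
    using subst_Y8_Y7_add[of "Var 7 - Var 8" "Var 8"] by (simp add: subst_Y8_Y7_Var)
  then have "(\<lambda>p. total_degree (subst_Y8_Y7 p)) ` restr p = {total_degree (subst_Y8_Y7 p)}"
    by (auto simp: restr_eq subst_Y8_Y7_add subst_Y8_Y7_mult image_iff)
  then show ?thesis by (simp add: degree_T_def)
qed

lemma carrier_R_T: "carrier R_T = range restr"
  by (auto simp: R_T_def FactRing_def A_RCOSETS_def RCOSETS_def restr_def a_r_coset_def
      P8_sel P8_def ring_of_type_algebra_def)

end

theory Submission
  imports Defs
begin

text \<open>
The roots \<open>b\<close> of the generating cubics are the roots of inner product one with \<open>e_7 - e_8\<close>, and the
hyperplane is the orthogonal complement of \<open>e_7 - e_8\<close>. A root of the hyperplane is neither \<open>b\<close> nor \<open>-b\<close>,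
so its inner product with \<open>b\<close> is \<open>-1\<close>, \<open>0\<close> or \<open>1\<close> (\<open>E8_inner_small\<close>) and all generators vanish on the
roots. Conversely, at a common zero the linear forms \<open>b\<close> take values in \<open>{-1, 0, 1}\<close>; this makes the
zero a real vector with all entries integral or all entries half-integral. It is then a root, by the
norm equation in the first case and by the remaining cubics in the second (\<open>zero_set_I_gen\<close>).

The ideal is radical because each cubic splits into distinct linear factors. Modulo the
ideal, multiplication by each form \<open>b\<close> is diagonalizable with eigenvalues \<open>-1\<close>, \<open>0\<close>, \<open>1\<close>, and since these
multiplications commute, the unit is a sum of joint eigenvectors
(\<open>joint_eigenvectors_generate_unit\<close>). The forms span all linear forms on the hyperplane, so a joint
eigenvector belongs to a point of the hyperplane and polynomials act on it through their value at
that point (\<open>eigen_evaluation\<close>). A point outside the zero set contributes nothing modulo the ideal,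
and at a root a polynomial vanishing on the roots acts as zero. Hence such a polynomial lies in the
ideal (\<open>vanishing_subset_I_gen\<close>): the ideal is the whole vanishing ideal of the roots. This gives
radicality and, since the generators have degree at most three, the last claim.

For the smallest degree, a polynomial of degree at most two has few coefficients, and
evaluating it at suitable roots shows that it is a scalar multiple of the norm equation
(\<open>quadric_through_E7\<close>). A generating cubic is not divisible by the norm
equation, because it has a non-zero value at some point of squared length two
(\<open>nontrivial_cubic\<close>).
\<close>

unbundle inner_syntax

section \<open>Splitting the unit into joint eigenvectors\<close>

text \<open>Modulo \<open>J\<close>, multiplication by each \<open>u b\<close> is killed by \<open>(t - 1) * t * (t + 1)\<close>. Lagrange
interpolation at the three roots \<open>-1\<close>, \<open>0\<close>, \<open>1\<close> therefore writes every element as a sum of three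
eigenvectors of \<open>u b\<close>. The multiplications commute, so splitting for one more \<open>b\<close> does not destroy the
eigenvector property for the previous ones; after all of \<open>B\<close> the unit is a sum of joint
eigenvectors. An additively closed \<open>M\<close> thus contains the unit once it contains every joint
eigenvector. In geometric terms the joint eigenvectors are multiples of the indicator functions
of the points of the grid \<open>{-1, 0, 1} ^ B\<close>, but phrasing it this way allows the forms \<open>u b\<close> to be
linearly dependent, so that no coordinates have to be chosen.\<close>

lemma joint_eigenvectors_generate_unit:
  fixes J M :: "'a::comm_ring_1 set" and half :: 'a and u :: "'b \<Rightarrow> 'a"
  assumes "finite B"
    and J_mult: "\<And>r x. x \<in> J \<Longrightarrow> r * x \<in> J"
    and M_add: "\<And>x y. x \<in> M \<Longrightarrow> y \<in> M \<Longrightarrow> x + y \<in> M"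
    and cubic: "\<And>b. b \<in> B \<Longrightarrow> (u b - 1) * u b * (u b + 1) \<in> J"
    and half: "half * 2 = 1"
    and eig: "\<And>s g. (\<And>b. b \<in> B \<Longrightarrow> g b \<in> {-1, 0, 1 :: int} \<and> (u b - of_int (g b)) * s \<in> J) \<Longrightarrow> s \<in> M"
  shows "1 \<in> M"
proof -
  define eigen where "eigen F g s \<longleftrightarrow>
    (\<forall>b\<in>F. g b \<in> {-1, 0, 1 :: int} \<and> (u b - of_int (g b)) * s \<in> J)" for F g s
  have "(\<forall>s g. eigen F g s \<longrightarrow> s \<in> M) \<longrightarrow> 1 \<in> M" if "F \<subseteq> B" for F
    using finite_subset[OF that \<open>finite B\<close>] that
  proof (induction F rule: finite_induct)
    case empty
    show ?case by (simp add: eigen_def)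
  next
    case (insert b F)
    have "s \<in> M" if all: "\<forall>s g. eigen (insert b F) g s \<longrightarrow> s \<in> M" and s: "eigen F g s" for s g
    proof -
      have C: "(u b - 1) * u b * (u b + 1) \<in> J"
        using cubic insert.prems by blast
      have part: "e * s \<in> M"
        if c: "c \<in> {-1, 0, 1 :: int}" and e: "(u b - of_int c) * e = r * ((u b - 1) * u b * (u b + 1))"
        for e c r
      proof -
        have "(u b - of_int c) * (e * s) = (r * s) * ((u b - 1) * u b * (u b + 1))"
          using arg_cong[OF e, of "\<lambda>x. x * s"] by (simp only: mult_ac)
        then have "(u b - of_int c) * (e * s) \<in> J"
          using J_mult[OF C, of "r * s"] by (simp only:)
        moreover have "(u d - of_int (g d)) * (e * s) \<in> J" if "d \<in> F" for d
        proof -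
          have "e * ((u d - of_int (g d)) * s) \<in> J"
            using s that by (auto simp: eigen_def intro: J_mult[of "(u d - of_int (g d)) * s"])
          then show ?thesis by (simp only: mult_ac)
        qed
        ultimately have "eigen (insert b F) (g(b := c)) (e * s)"
          using s c insert.hyps by (auto simp: eigen_def)
        then show ?thesis using all by blast
      qed
      \<comment> \<open>The three Lagrange polynomials of the nodes \<open>-1\<close>, \<open>0\<close> and \<open>1\<close> in \<open>u b\<close>; they add up to one.\<close>
      have "(half * (u b * (u b - 1))) * s \<in> M"
        by (rule part[of "-1" _ half]) (simp_all add: algebra_simps)
      moreover have "(1 - u b * u b) * s \<in> M"
        by (rule part[of 0 _ "-1"]) (simp_all add: algebra_simps)
      moreover have "(half * (u b * (u b + 1))) * s \<in> M"
        by (rule part[of 1 _ half]) (simp_all add: algebra_simps)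
      ultimately have "(half * (u b * (u b - 1))) * s + (1 - u b * u b) * s
          + (half * (u b * (u b + 1))) * s \<in> M"
        by (intro M_add)
      moreover have "(half * (u b * (u b - 1))) * s + (1 - u b * u b) * s
          + (half * (u b * (u b + 1))) * s = s + (half * 2 - 1) * (u b * u b * s)"
        by (simp add: algebra_simps)
      ultimately show ?thesis by (simp add: half)
    qed
    then show ?case using insert by blast
  qed
  from this[of B] eig show ?thesis by (auto simp: eigen_def)
qed


section \<open>Polynomials in eight variables\<close>

lemma UNIV_8: "(UNIV :: 8 set) = {1, 2, 3, 4, 5, 6, 7, 8}"
  by (rule sym, rule card_subset_eq) simp_all

lemma sum_8: "(\<Sum>i\<in>(UNIV :: 8 set). f i) = f 1 + f 2 + f 3 + f 4 + f 5 + f 6 + f 7 + (f 8 :: 'a :: comm_monoid_add)"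
  unfolding UNIV_8 by (simp add: add_ac)

lemma Const_1: "Const 1 = 1" by (simp add: Const_def)
lemma Const_minus: "Const (- a) = - Const a"
  using Const_hom(2)[of a "- a"] by (simp add: Const_hom(1) eq_neg_iff_add_eq_0 add.commute)
lemma Const_diff: "Const (a - b) = Const a - Const b"
  using Const_hom(2)[of a "- b"] by (simp add: Const_minus)
lemma Const_of_nat: "Const (of_nat k) = of_nat k"
  by (induction k) (simp_all add: Const_hom Const_1)
lemma Const_of_int: "of_int k = Const (of_int k)"
  by (cases k) (simp_all add: Const_of_nat Const_minus flip: of_nat_Suc)
lemma Const_numeral: "Const (numeral n) = numeral n"
  using Const_of_nat[of "numeral n"] by simp
lemma Const_half: "Const (1/2) * 2 = 1"
  using Const_hom(3)[of "1/2" 2] by (simp add: Const_numeral Const_1)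

lemma poly_eval_Const [simp]: "poly_eval y (Const c) = c"
  by (simp add: poly_eval_def Const_def poly_subst_single)
lemma poly_eval_0 [simp]: "poly_eval y 0 = 0" using poly_eval_Const[of y 0] by (simp add: Const_hom)
lemma poly_eval_1 [simp]: "poly_eval y 1 = 1" using poly_eval_Const[of y 1] by (simp add: Const_1)
lemma poly_eval_numeral [simp]: "poly_eval y (numeral n) = numeral n"
  using poly_eval_Const[of y "numeral n"] by (simp add: Const_numeral)
lemma poly_eval_minus [simp]: "poly_eval y (- p) = - poly_eval y p"
  using poly_eval_add[of y p "- p"] by (simp add: eq_neg_iff_add_eq_0 add.commute)
lemma poly_eval_diff [simp]: "poly_eval y (p - q) = poly_eval y p - poly_eval y q"
  using poly_eval_add[of y p "- q"] by simp
lemma poly_eval_sum [simp]: "poly_eval y (sum f A) = (\<Sum>a\<in>A. poly_eval y (f a))"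
  by (induction A rule: infinite_finite_induct) (simp_all add: poly_eval_add)
lemma poly_eval_power [simp]: "poly_eval y (p ^ n) = poly_eval y p ^ n"
  by (induction n) (simp_all add: poly_eval_mult)
declare poly_eval_add [simp] poly_eval_mult [simp] poly_eval_Var [simp]

lemma single_eq_monomial:
  "(Poly_Mapping.single m c :: poly8) = Const c * (\<Prod>i\<in>UNIV. Var i ^ Poly_Mapping.lookup m i)"
proof -
  have pw: "Var i ^ n = Poly_Mapping.single (Poly_Mapping.single i n) 1" for i n
    by (induction n) (simp_all add: Var_def mult_single single_add[symmetric] add.commute)
  have "(\<Prod>i\<in>A. Var i ^ Poly_Mapping.lookup m i)
      = Poly_Mapping.single (\<Sum>i\<in>A. Poly_Mapping.single i (Poly_Mapping.lookup m i)) 1" for A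
    by (induction A rule: infinite_finite_induct) (simp_all add: pw mult_single)
  moreover have "(\<Sum>i\<in>UNIV. Poly_Mapping.single i (Poly_Mapping.lookup m i)) = m"
    by (rule poly_mapping_eqI) (simp add: lookup_sum lookup_single when_def)
  ultimately show ?thesis by (simp add: Const_def mult_single)
qed

lemma poly8_induct [case_names Const Var add mult]:
  assumes c: "\<And>c. P (Const c)" and v: "\<And>i. P (Var i)"
    and a: "\<And>p q. P p \<Longrightarrow> P q \<Longrightarrow> P (p + q)" and m: "\<And>p q. P p \<Longrightarrow> P q \<Longrightarrow> P (p * q)"
  shows "P p"
proof -
  have 1: "P 1" using c[of 1] by (simp add: Const_1)
  have 0: "P 0" using c[of 0] by (simp add: Const_hom)
  have pw: "P (q ^ n)" if "P q" for q n by (induction n) (simp_all add: 1 m that)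
  have "P (\<Prod>i\<in>A. Var i ^ f i)" for A f
    by (induction A rule: infinite_finite_induct) (simp_all add: 1 m pw v)
  then have mon: "P (Poly_Mapping.single k d)" for k d
    unfolding single_eq_monomial by (intro m c)
  have "P (\<Sum>k\<in>A. Poly_Mapping.single k (f k))" for A f
    by (induction A rule: infinite_finite_induct) (simp_all add: 0 a mon)
  then show ?thesis by (subst poly8_expansion)
qed


section \<open>The coordinate ring of the hyperplane\<close>

lemma ideal_KT: "ideal KT P8"
  unfolding KT_def using ring.genideal_ideal[OF cring.axioms(1)[OF cring_P8]] by (simp add: P8_sel)

lemma cring_R_T: "cring R_T"
  unfolding R_T_def using ideal.quotient_is_cring[OF ideal_KT cring_P8] .

lemma ring_R_T: "ring R_T" using cring_R_T by (rule cring.axioms(1))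

lemma restr_carrier [simp]: "restr p \<in> carrier R_T"
  by (auto simp: carrier_R_T)

lemma restr_hom: "restr \<in> ring_hom P8 R_T"
proof -
  have "restr = (+>\<^bsub>P8\<^esub>) KT" by (rule ext) (simp add: restr_def)
  then show ?thesis unfolding R_T_def using ideal.rcos_ring_hom[OF ideal_KT] by simp
qed

lemma restr_add: "restr (p + q) = restr p \<oplus>\<^bsub>R_T\<^esub> restr q"
  and restr_mult: "restr (p * q) = restr p \<otimes>\<^bsub>R_T\<^esub> restr q"
  and restr_1: "restr 1 = \<one>\<^bsub>R_T\<^esub>"
  using ring_hom_add[OF restr_hom] ring_hom_mult[OF restr_hom] ring_hom_one[OF restr_hom]
  by (simp_all add: P8_sel)

lemma restr_0: "restr 0 = \<zero>\<^bsub>R_T\<^esub>"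
proof -
  interpret R: cring R_T by (rule cring_R_T)
  have "restr 0 \<oplus>\<^bsub>R_T\<^esub> restr 0 = restr 0" by (simp flip: restr_add)
  then show ?thesis using R.add.l_cancel_one[of "restr 0" "restr 0"] by simp
qed

lemma restr_minus: "restr (- p) = \<ominus>\<^bsub>R_T\<^esub> restr p"
proof -
  interpret R: cring R_T by (rule cring_R_T)
  have "restr (- p) \<oplus>\<^bsub>R_T\<^esub> restr p = \<zero>\<^bsub>R_T\<^esub>" by (simp flip: restr_add add: restr_0)
  then show ?thesis by (simp add: R.minus_equality)
qed

lemma restr_pow: "restr p [^]\<^bsub>R_T\<^esub> (n::nat) = restr (p ^ n)"
  by (induction n) (simp_all add: restr_1 restr_mult mult.commute cring.cring_simprules[OF cring_R_T])

lemma restr_Var_8: "restr (Var 8) = restr (Var 7)"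
proof -
  have "restr (Var 7 - Var 8) = restr 0"
  proof (intro Set.set_eqI iffI)
    fix x assume "x \<in> restr (Var 7 - Var 8)"
    then obtain q where "x = q * (Var 7 - Var 8) + (Var 7 - Var 8)" by (auto simp: restr_eq)
    then have "x = (q + 1) * (Var 7 - Var 8) + 0" by (simp add: algebra_simps)
    then show "x \<in> restr 0" unfolding restr_eq by blast
  next
    fix x assume "x \<in> restr 0"
    then obtain q where "x = q * (Var 7 - Var 8)" by (auto simp: restr_eq)
    then have "x = (q - 1) * (Var 7 - Var 8) + (Var 7 - Var 8)" by (simp add: algebra_simps)
    then show "x \<in> restr (Var 7 - Var 8)" unfolding restr_eq by blast
  qed
  then have "restr (Var 8 + (Var 7 - Var 8)) = restr (Var 8 + 0)"
    by (simp only: restr_add)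
  then show ?thesis by simp
qed

lemma subst_Const: "subst_Y8_Y7 (Const c) = Const c"
  unfolding subst_Y8_Y7_def by (simp add: poly_subst_single Const_hom Const_def)

lemma restr_subst: "restr (subst_Y8_Y7 p) = restr p"
proof (induction p rule: poly8_induct)
  case (Const c)
  show ?case by (simp add: subst_Const)
qed (simp_all add: subst_Y8_Y7_Var restr_Var_8 subst_Y8_Y7_add subst_Y8_Y7_mult restr_add restr_mult)

text \<open>These closure rules allow an ideal of the quotient ring to be handled through the polynomials
whose restrictions lie in it, with type-class arithmetic in place of the ring operations of the
quotient.\<close>

lemma ideal_restr:
  assumes "ideal K R_T"
  shows ideal_restr_add: "restr p \<in> K \<Longrightarrow> restr q \<in> K \<Longrightarrow> restr (p + q) \<in> K"
    and ideal_restr_mult: "restr p \<in> K \<Longrightarrow> restr (q * p) \<in> K"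
    and ideal_restr_diff: "restr p \<in> K \<Longrightarrow> restr q \<in> K \<Longrightarrow> restr (p - q) \<in> K"
proof -
  interpret K: ideal K R_T by (rule assms)
  show mult: "restr p \<in> K \<Longrightarrow> restr (q * p) \<in> K" for p q
    by (simp add: restr_mult K.I_l_closed)
  show add: "restr p \<in> K \<Longrightarrow> restr q \<in> K \<Longrightarrow> restr (p + q) \<in> K" for p q
    by (simp add: restr_add K.a_closed)
  show "restr p \<in> K \<Longrightarrow> restr q \<in> K \<Longrightarrow> restr (p - q) \<in> K"
    using add[of p "- q"] mult[of q "-1"] by simp
qed

lemma vanishing_ideal_restr:
  assumes "S \<subseteq> T_space"
  shows "restr p \<in> vanishing_ideal S \<longleftrightarrow> (\<forall>y\<in>S. poly_eval y p = 0)"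
  using assms by (auto simp: vanishing_ideal_def value_restr subset_iff)

lemma ideal_vanishing_ideal:
  assumes "S \<subseteq> T_space"
  shows "ideal (vanishing_ideal S) R_T"
proof -
  interpret R: cring R_T by (rule cring_R_T)
  note van = vanishing_ideal_restr[OF assms]
  have rep: "x \<in> vanishing_ideal S \<Longrightarrow> \<exists>p. x = restr p" for x
    by (auto simp: vanishing_ideal_def carrier_R_T)
  show ?thesis
  proof (rule idealI)
    show "ring R_T" by (rule ring_R_T)
    show "subgroup (vanishing_ideal S) (add_monoid R_T)"
    proof (rule R.add.subgroupI)
      show "vanishing_ideal S \<subseteq> carrier R_T" by (auto simp: vanishing_ideal_def)
      show "vanishing_ideal S \<noteq> {}" using van[of 0] by auto
      fix a assume a: "a \<in> vanishing_ideal S"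
      show "\<ominus>\<^bsub>R_T\<^esub> a \<in> vanishing_ideal S"
        using rep[OF a] a by (auto simp: van simp flip: restr_minus)
      fix b assume b: "b \<in> vanishing_ideal S"
      show "a \<oplus>\<^bsub>R_T\<^esub> b \<in> vanishing_ideal S"
        using rep[OF a] rep[OF b] a b by (auto simp: van simp flip: restr_add)
    qed
    fix a x assume a: "a \<in> vanishing_ideal S" and x: "x \<in> carrier R_T"
    show "x \<otimes>\<^bsub>R_T\<^esub> a \<in> vanishing_ideal S" "a \<otimes>\<^bsub>R_T\<^esub> x \<in> vanishing_ideal S"
      using rep[OF a] a x by (auto simp: van carrier_R_T simp flip: restr_mult)
  qed
qed

lemma radical_vanishing_ideal:
  assumes "S \<subseteq> T_space"
  shows "radical_ideal R_T (vanishing_ideal S)"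
  unfolding radical_ideal_def
  using assms by (auto simp: ideal_vanishing_ideal carrier_R_T restr_pow vanishing_ideal_restr)


text \<open>If \<open>s\<close> is, modulo the ideal, an eigenvector of every coordinate function with eigenvalue \<open>y $ i\<close>, then
every polynomial acts on \<open>s\<close> through its value at the point \<open>y\<close>: the polynomials that do so form a
subring containing the constants and the coordinates.\<close>

lemma eigen_evaluation:
  fixes s :: poly8
  assumes K: "ideal K R_T"
    and coord: "\<And>i. restr ((Var i - Const (y $ i)) * s) \<in> K"
  shows "restr ((p - Const (poly_eval y p)) * s) \<in> K"
proof (induction p rule: poly8_induct)
  case (Const c)
  show ?case using ideal_restr_mult[OF K coord, of 0] by simp
next
  case (Var i)
  show ?case using coord by simp
next
  case (add p q)
  have "(p + q - Const (poly_eval y (p + q))) * s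
      = (p - Const (poly_eval y p)) * s + (q - Const (poly_eval y q)) * s"
    by (simp add: Const_hom algebra_simps)
  then show ?case using ideal_restr_add[OF K add] by simp
next
  case (mult p q)
  have "(p * q - Const (poly_eval y (p * q))) * s
      = q * ((p - Const (poly_eval y p)) * s)
        + Const (poly_eval y p) * ((q - Const (poly_eval y q)) * s)"
    by (simp add: Const_hom algebra_simps)
  then show ?case
    using ideal_restr_add[OF K ideal_restr_mult[OF K mult(1), of q]
        ideal_restr_mult[OF K mult(2), of "Const (poly_eval y p)"]] by simp
qed


section \<open>Inner products of roots\<close>

lemma axis_nth: "axis i (s::real) $ j = (if j = i then s else 0)" by (simp add: axis_def)

lemma half_square: "v \<in> {1/2, -1/2} \<Longrightarrow> v * v = (1/4::real)"
  by (elim insertE emptyE; hypsubst; simp)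

lemma half_mult:
  "\<lbrakk>x \<in> {1/2, -1/2}; y \<in> {1/2, -1/2}\<rbrakk>
    \<Longrightarrow> x * y = 1/4 - 1/2 * of_bool ((x < 0) \<noteq> (y < (0::real)))"
  by (elim insertE emptyE; hypsubst; simp)

lemma half_sum_Ints:
  "\<lbrakk>x \<in> {1/2, -1/2}; y \<in> {1/2, -1/2}; s \<in> {1, -1}; t \<in> {1, -1}\<rbrakk> \<Longrightarrow> s * x + t * y \<in> (\<int> :: real set)"
  by (elim insertE emptyE; hypsubst; simp)

lemma E8_norm:
  assumes "a \<in> E8"
  shows "a \<bullet> a = 2"
proof -
  from assms consider (ax) i j s t where "a = axis i s + axis j t" "i \<noteq> j" "s \<in> {1,-1}" "t \<in> {1,-1}"
    | (half) "\<forall>i. a $ i \<in> {1/2, -1/2}" unfolding E8_def by blast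
  then show ?thesis
  proof cases
    case ax then show ?thesis
      by (auto simp: inner_add_left inner_add_right inner_axis_axis)
  next
    case half
    have "a \<bullet> a = (\<Sum>i\<in>(UNIV::8 set). 1/4)"
      unfolding inner_vec_def inner_real_def by (intro sum.cong refl half_square) (use half in blast)
    then show ?thesis by simp
  qed
qed

text \<open>The only case that needs an argument is that of two half-integral roots: their inner product is
\<open>2 - n/2\<close>, where \<open>n\<close> counts the coordinates with different signs, and \<open>n\<close> is even because both
roots have an even number of minus signs.\<close>

lemma E8_int:
  assumes a: "a \<in> E8" and b: "b \<in> E8"
  shows "a \<bullet> b \<in> \<int>"
proof -
  have ah: "(axis i s + axis j t) \<bullet> v \<in> \<int>" if "s \<in> {1,-1}" "t \<in> {1,-1}" "\<forall>i. v $ i \<in> {1/2, -1/2}"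
    for i j :: 8 and s t :: real and v
  proof -
    have "v $ i \<in> {1/2, -1/2}" "v $ j \<in> {1/2, -1/2}" using that by blast+
    then have "s * v $ i + t * v $ j \<in> \<int>" using that(1,2) by (rule half_sum_Ints)
    then show ?thesis by (simp add: inner_add_left inner_axis')
  qed
  have aa: "(axis i s + axis j t) \<bullet> (axis k s' + axis l t') \<in> \<int>"
    if "s \<in> {1,-1}" "t \<in> {1,-1}" "s' \<in> {1,-1}" "t' \<in> {1,-1}"
    for i j k l :: 8 and s t s' t' :: real
    using that by (auto simp: inner_add_left inner_add_right inner_axis_axis)
  have hh: "v \<bullet> w \<in> \<int>" if v: "\<forall>i. v $ i \<in> {1/2, -1/2}" "even (card {i. v $ i < 0})"
    and w: "\<forall>i. w $ i \<in> {1/2, -1/2}" "even (card {i. w $ i < 0})" for v w :: "real^8"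
  proof -
    let ?V = "{i. v $ i < 0}" and ?W = "{i. w $ i < 0}"
    define n where "n = card (?V - ?W) + card (?W - ?V)"
    have "card ?V = card (?V - ?W) + card (?V \<inter> ?W)" "card ?W = card (?W - ?V) + card (?V \<inter> ?W)"
      by (subst card_Un_disjoint[symmetric]; auto intro: arg_cong[where f = card])+
    then have "even n" using v(2) w(2) by (auto simp: n_def)
    then obtain m where m: "n = 2 * m" ..
    have "v $ i * w $ i = 1/4 - (1/2) * of_bool (i \<in> (?V - ?W) \<union> (?W - ?V))" for i
    proof -
      have "i \<in> (?V - ?W) \<union> (?W - ?V) \<longleftrightarrow> (v $ i < 0) \<noteq> (w $ i < 0)" by auto
      then show ?thesis using half_mult[OF v(1)[rule_format, of i] w(1)[rule_format, of i]] by (simp only:)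
    qed
    then have "v \<bullet> w = (\<Sum>i\<in>UNIV. 1/4 - (1/2) * of_bool (i \<in> (?V - ?W) \<union> (?W - ?V)))"
      by (simp add: inner_vec_def)
    also have "\<dots> = 2 - (1/2) * (\<Sum>i\<in>UNIV. of_bool (i \<in> (?V - ?W) \<union> (?W - ?V)))"
      by (simp only: sum_subtractf sum_distrib_left[symmetric]) simp
    also have "(\<Sum>i\<in>UNIV. of_bool (i \<in> (?V - ?W) \<union> (?W - ?V))) = real (card ((?V - ?W) \<union> (?W - ?V)))"
      by (simp only: sum_of_bool_eq finite Int_UNIV_left Collect_mem_eq)
    also have "card ((?V - ?W) \<union> (?W - ?V)) = n"
      unfolding n_def by (rule card_Un_disjoint) auto
    finally show ?thesis by (simp add: m)
  qed
  have ha: "v \<bullet> (axis i s + axis j t) \<in> \<int>" if "s \<in> {1,-1}" "t \<in> {1,-1}" "\<forall>i. v $ i \<in> {1/2, -1/2}"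
    for i j :: 8 and s t :: real and v
    by (subst inner_commute) (rule ah[OF that])
  have cases: P if "v \<in> E8"
    and "\<And>i j s t. v = axis i s + axis j t \<Longrightarrow> s \<in> {1,-1} \<Longrightarrow> t \<in> {1,-1} \<Longrightarrow> P"
    and "(\<forall>i. v $ i \<in> {1/2, -1/2}) \<Longrightarrow> even (card {i. v $ i < 0}) \<Longrightarrow> P" for v P
    using that unfolding E8_def by blast
  show ?thesis
  proof (rule cases[OF a])
    fix i j s t assume 1: "a = axis i s + axis j t" "s \<in> {1,-1}" "t \<in> {1,-1}"
    show ?thesis
    proof (rule cases[OF b])
      fix k l s' t' assume 2: "b = axis k s' + axis l t'" "s' \<in> {1,-1}" "t' \<in> {1,-1}"
      show ?thesis unfolding 1(1) 2(1) by (rule aa[OF 1(2,3) 2(2,3)])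
    next
      assume "\<forall>i. b $ i \<in> {1/2, -1/2}"
      then show ?thesis unfolding 1(1) by (rule ah[OF 1(2,3)])
    qed
  next
    assume 1: "\<forall>i. a $ i \<in> {1/2, -1/2}" "even (card {i. a $ i < 0})"
    show ?thesis
    proof (rule cases[OF b])
      fix k l s' t' assume 2: "b = axis k s' + axis l t'" "s' \<in> {1,-1}" "t' \<in> {1,-1}"
      show ?thesis unfolding 2(1) by (rule ha[OF 2(2,3) 1(1)])
    next
      assume "\<forall>i. b $ i \<in> {1/2, -1/2}" "even (card {i. b $ i < 0})"
      then show ?thesis by (rule hh[OF 1])
    qed
  qed
qed

text \<open>Distinct and non-opposite roots \<open>a\<close>, \<open>b\<close> have \<open>a \<plusminus> b\<close> of positive length, which confines the integer
\<open>a \<bullet> b\<close> strictly between \<open>-2\<close> and \<open>2\<close>. This is why the cubics vanish on the roots of the hyperplane.\<close>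

lemma E8_inner_small:
  assumes "a \<in> E8" "b \<in> E8" "a \<noteq> b" "a \<noteq> - b"
  shows "a \<bullet> b \<in> {-1, 0, 1}"
proof -
  have "0 < (a - b) \<bullet> (a - b)" "0 < (a + b) \<bullet> (a + b)"
    using assms by (simp_all add: eq_neg_iff_add_eq_0)
  then have "\<bar>a \<bullet> b\<bar> < 2"
    using E8_norm[OF assms(1)] E8_norm[OF assms(2)]
    by (simp add: inner_add_left inner_add_right inner_diff_left inner_diff_right inner_commute)
  moreover obtain k where k: "a \<bullet> b = of_int k" using E8_int[OF assms(1,2)] by (auto elim: Ints_cases)
  ultimately have "k \<in> {-1, 0, 1}" by auto
  then show ?thesis using k by auto
qed

lemma axis_E8: "i \<noteq> j \<Longrightarrow> s \<in> {1,-1} \<Longrightarrow> t \<in> {1,-1} \<Longrightarrow> axis i s + axis j t \<in> E8"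
  unfolding E8_def by blast

lemma integral_root:
  fixes a :: "real^8"
  assumes "\<And>i. a $ i \<in> {-1, 0, 1}" "a \<bullet> a = 2"
  shows "a \<in> E8"
proof -
  let ?S = "{i. a $ i \<noteq> 0}"
  have "a $ i * a $ i = of_bool (i \<in> ?S)" for i using assms(1)[of i] by auto
  then have "a \<bullet> a = real (card ?S)" by (simp add: inner_vec_def)
  then have "card ?S = 2" using assms(2) by simp
  then obtain i j where ij: "?S = {i, j}" "i \<noteq> j" by (auto simp: card_2_iff)
  have "a = axis i (a $ i) + axis j (a $ j)"
    unfolding vec_eq_iff using ij by (auto simp: axis_nth)
  moreover have "a $ i \<in> {1, -1}" "a $ j \<in> {1, -1}" using assms(1)[of i] assms(1)[of j] ij by auto
  ultimately show ?thesis using axis_E8[OF ij(2), of "a $ i" "a $ j"] by simp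
qed

text \<open>A vector with entries \<open>1/2\<close> and \<open>-1/2\<close> fails to be a root only through the parity of its minus signs.
In that case its last two entries, being equal, can be replaced by \<open>1/2\<close> and \<open>-1/2\<close>, which changes
the parity: the result \<open>b\<close> is a root, and \<open>b \<bullet> a\<close> is \<open>6/4\<close>, from the first six coordinates.\<close>

lemma half_integral_root:
  fixes a :: "real^8"
  assumes half: "\<And>i. a $ i \<in> {1/2, -1/2}" and "a $ 7 = a $ 8"
    and B: "\<And>b. b \<in> E8 \<Longrightarrow> b $ 7 - b $ 8 = 1 \<Longrightarrow> b \<bullet> a \<in> {-1, 0, 1}"
  shows "a \<in> E8"
proof (rule ccontr)
  assume "a \<notin> E8"
  then have odd: "odd (card {i. a $ i < 0})" using half by (auto simp: E8_def)
  define b :: "real^8" where "b = (\<chi> i. if i = 7 then 1/2 else if i = 8 then -1/2 else a $ i)"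
  have bn: "b $ i = (if i = 7 then 1/2 else if i = 8 then -1/2 else a $ i)" for i
    by (simp add: b_def)
  have half_b: "b $ i \<in> {1/2, -1/2}" for i using half[of i] by (auto simp: bn)
  have neq: "(7::8) \<noteq> 8" by simp
  let ?N = "{i. a $ i < 0} - {7, 8}"
  have "{i. b $ i < 0} = insert 8 ?N" by (auto simp: bn)
  then have cb: "card {i. b $ i < 0} = Suc (card ?N)" by simp
  define D :: "8 set" where "D = (if a $ 8 < 0 then {7, 8} else {})"
  have "{i. a $ i < 0} = D \<union> ?N" using assms(2) by (auto simp: D_def)
  moreover have "card (D \<union> ?N) = card D + card ?N"
    by (rule card_Un_disjoint) (auto simp: D_def)
  ultimately have "card {i. a $ i < 0} = (if a $ 8 < 0 then 2 else 0) + card ?N"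
    using neq by (simp add: D_def)
  then have "even (card {i. b $ i < 0})" using odd cb by (auto split: if_splits)
  then have "b \<in> E8" using half_b unfolding E8_def by blast
  moreover have "b $ 7 - b $ 8 = 1" using neq by (simp add: bn)
  ultimately have "b \<bullet> a \<in> {-1, 0, 1}" by (rule B)
  moreover have "b \<bullet> a = 3/2"
  proof -
    have sq: "a $ i * a $ i = 1/4" for i by (rule half_square[OF half])
    show ?thesis using assms(2) by (simp add: inner_vec_def sum_8 bn sq)
  qed
  ultimately show False by simp
qed


section \<open>The zero set of the ideal\<close>

abbreviation norm_poly :: poly8 where
  "norm_poly \<equiv> (\<Sum>i\<in>UNIV. Var i ^ 2) - 2"

abbreviation generator_roots :: "(real^8) set" where
  "generator_roots \<equiv> {b \<in> E8. b $ 7 - b $ 8 = 1}"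

abbreviation generators :: "poly8 set set" where
  "generators \<equiv> insert Nm {cubic b | b. b \<in> E8 \<and> b $ 7 - b $ 8 = 1}"

lemma complexify_nth [simp]: "complexify a $ i = complex_of_real (a $ i)"
  by (simp add: complexify_def)

lemma complexify_E7_T: "complexify ` E7 \<subseteq> T_space"
  by (auto simp: E7_def T_space_def)

lemma poly_eval_lin: "poly_eval y (lin b) = (\<Sum>i\<in>UNIV. complex_of_real (b $ i) * y $ i)"
  by (simp add: lin_def)

lemma poly_eval_lin_complexify: "poly_eval (complexify a) (lin b) = complex_of_real (b \<bullet> a)"
  by (simp add: poly_eval_lin inner_vec_def)

lemma cubic_zero_iff: "(x - 1) * x * (x + 1) = 0 \<longleftrightarrow> x \<in> {-1, 0, 1 :: complex}"
  by (auto simp: eq_neg_iff_add_eq_0)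

lemma generators_vanish:
  assumes "g \<in> generators"
  shows "g \<in> vanishing_ideal (complexify ` E7)"
proof -
  have "poly_eval (complexify a) norm_poly = 0" if "a \<in> E8" for a
  proof -
    have "(\<Sum>i\<in>UNIV. complexify a $ i ^ 2) = complex_of_real (a \<bullet> a)"
      by (simp add: inner_vec_def power2_eq_square)
    then show ?thesis using E8_norm[OF that] by simp
  qed
  moreover have "poly_eval (complexify a) ((lin b - 1) * lin b * (lin b + 1)) = 0"
    if "a \<in> E7" "b \<in> E8" "b $ 7 - b $ 8 = 1" for a b
  proof -
    have "a \<in> E8" "a $ 7 = a $ 8" using that(1) by (auto simp: E7_def)
    then have "b \<bullet> a \<in> {-1, 0, 1}"
      using that by (intro E8_inner_small) auto
    then show ?thesis
      unfolding poly_eval_mult poly_eval_add poly_eval_diff poly_eval_1 cubic_zero_iff poly_eval_lin_complexify by auto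
  qed
  ultimately show ?thesis
    using assms by (auto simp: Nm_def cubic_def E7_def vanishing_ideal_restr[OF complexify_E7_T, unfolded E7_def])
qed

lemma generators_carrier: "generators \<subseteq> carrier R_T"
  by (auto simp: Nm_def cubic_def)

lemma ideal_I_gen: "ideal I_gen R_T"
  unfolding I_gen_def by (rule ring.genideal_ideal[OF ring_R_T generators_carrier])

lemma generators_in_I_gen: "generators \<subseteq> I_gen"
  unfolding I_gen_def by (rule ring.genideal_self[OF ring_R_T generators_carrier])

lemma I_gen_subset: "I_gen \<subseteq> vanishing_ideal (complexify ` E7)"
  unfolding I_gen_def
  by (rule ring.genideal_minimal[OF ring_R_T ideal_vanishing_ideal[OF complexify_E7_T]])
    (use generators_vanish in blast)

lemma axis_pair_generator: "i \<noteq> 7 \<Longrightarrow> i \<noteq> 8 \<Longrightarrow> s \<in> {1, -1} \<Longrightarrow>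
    axis 7 1 + axis i s \<in> E8 \<and> (axis 7 1 + axis i s :: real^8) $ 7 - (axis 7 1 + axis i s :: real^8) $ 8 = 1"
  using axis_E8[of 7 i 1 s] by (auto simp: axis_nth)

lemma lin_axis_pair: "lin (axis i s + axis j t) = Const (of_real s) * Var i + Const (of_real t) * Var j"
proof -
  have "lin (axis i s + axis j t) = (\<Sum>k\<in>UNIV. (if k = i then Const (of_real s) * Var i else 0)
     + (if k = j then Const (of_real t) * Var j else 0))"
    unfolding lin_def by (rule sum.cong) (auto simp: axis_nth Const_hom algebra_simps)
  then show ?thesis by (simp add: sum.distrib)
qed

text \<open>The roots \<open>axis 7 1 \<plusminus> axis i 1\<close> force \<open>y $ 7 \<plusminus> y $ i\<close> into \<open>{-1, 0, 1}\<close>. Solving for the two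
coordinates leaves only real values: both integral or both half-integral, and \<open>y $ 7\<close> decides
which of the two it is for all \<open>i\<close> at once.\<close>

lemma integral_half_integral_real:
  fixes y :: "complex^8"
  assumes T: "y $ 7 = y $ 8"
    and p: "\<And>i. i \<noteq> 7 \<Longrightarrow> i \<noteq> 8 \<Longrightarrow> y $ 7 + y $ i \<in> {-1, 0, 1}"
    and m: "\<And>i. i \<noteq> 7 \<Longrightarrow> i \<noteq> 8 \<Longrightarrow> y $ 7 - y $ i \<in> {-1, 0, 1}"
  shows "(\<exists>a. y = complexify a \<and> (\<forall>i. a $ i \<in> {-1, 0, 1})) \<or> (\<exists>a. y = complexify a \<and> (\<forall>i. a $ i \<in> {1/2, -1/2}))"
proof -
  have sd: "((p + q) / 2 = 0 \<and> (p - q) / 2 \<in> {-1, 0, 1}) \<or> ((p + q) / 2 \<in> {1, -1} \<and> (p - q) / 2 = 0)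
      \<or> ((p + q) / 2 \<in> {1/2, -1/2} \<and> (p - q) / 2 \<in> {1/2, -1/2})"
    if "p \<in> {-1, 0, 1}" "q \<in> {-1, 0, 1}" for p q :: complex
    using that by (elim insertE emptyE; hypsubst; simp)
  have solve: "(c = 0 \<and> d \<in> {-1,0,1}) \<or> (c \<in> {1,-1} \<and> d = 0) \<or> (c \<in> {1/2,-1/2} \<and> d \<in> {1/2,-1/2})"
    if "c + d \<in> {-1, 0, 1}" "c - d \<in> {-1, 0, 1}" for c d :: complex
  proof -
    have "((c + d) + (c - d)) / 2 = c" "((c + d) - (c - d)) / 2 = d" by simp_all
    with sd[OF that] show ?thesis by (simp only:)
  qed
  have s: "(y $ 7 = 0 \<and> y $ i \<in> {-1,0,1}) \<or> (y $ 7 \<in> {1,-1} \<and> y $ i = 0) \<or> (y $ 7 \<in> {1/2,-1/2} \<and> y $ i \<in> {1/2,-1/2})"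
    if "i \<noteq> 7" "i \<noteq> 8" for i
    by (rule solve[OF p[OF that] m[OF that]])
  have "(1::8) \<noteq> 7" "(1::8) \<noteq> 8" by simp_all
  then consider "y $ 7 \<in> {-1, 0, 1}" | "y $ 7 \<in> {1/2, -1/2}" using s[of 1] by auto
  then show ?thesis
  proof cases
    case 1
    then have not_half: "y $ 7 \<notin> {1/2, -1/2}" by (auto simp: complex_eq_iff)
    have "y $ i \<in> {-1, 0, 1}" for i
    proof (cases "i = 7 \<or> i = 8")
      case True then show ?thesis using 1 T by auto
    next
      case False then show ?thesis using s[of i] not_half by blast
    qed
    then have "y = complexify (\<chi> i. Re (y $ i)) \<and> (\<forall>i. (\<chi> i. Re (y $ i)) $ i \<in> {-1, 0, 1})"
      by (auto simp: vec_eq_iff complex_eq_iff)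
    then show ?thesis by blast
  next
    case 2
    then have not_int: "y $ 7 \<noteq> 0" "y $ 7 \<notin> {1, -1}" by (auto simp: complex_eq_iff)
    have "y $ i \<in> {1/2, -1/2}" for i
    proof (cases "i = 7 \<or> i = 8")
      case True then show ?thesis using 2 T by auto
    next
      case False then show ?thesis using s[of i] not_int by blast
    qed
    then have "y = complexify (\<chi> i. Re (y $ i)) \<and> (\<forall>i. (\<chi> i. Re (y $ i)) $ i \<in> {1/2, -1/2})"
      by (auto simp: vec_eq_iff complex_eq_iff)
    then show ?thesis by blast
  qed
qed

text \<open>A zero \<open>y\<close> of the ideal is a real vector with all entries integral or all entries half-integral.
In the integral case the equation of squared length two leaves two entries \<open>1\<close> or \<open>-1\<close>; in the
half-integral case the remaining cubics fix the parity of the minus signs.\<close>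

lemma zero_set_I_gen: "zero_set I_gen = complexify ` E7"
proof
  have "value_at f y = 0" if "f \<in> I_gen" "y \<in> complexify ` E7" for f y
    using that I_gen_subset by (auto simp: vanishing_ideal_def)
  then show "complexify ` E7 \<subseteq> zero_set I_gen"
    using complexify_E7_T by (auto simp: zero_set_def)
next
  show "zero_set I_gen \<subseteq> complexify ` E7"
  proof
    fix y assume y: "y \<in> zero_set I_gen"
    then have T: "y \<in> T_space" by (simp add: zero_set_def)
    have van: "poly_eval y p = 0" if "restr p \<in> I_gen" for p
      using y that value_restr[OF T, of p] by (auto simp: zero_set_def)
    have nm: "(\<Sum>i\<in>UNIV. y $ i ^ 2) = 2"
      using van[of norm_poly] generators_in_I_gen by (simp add: Nm_def)
    have u: "poly_eval y (lin b) \<in> {-1, 0, 1}" if "b \<in> E8" "b $ 7 - b $ 8 = 1" for b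
    proof -
      have "restr ((lin b - 1) * lin b * (lin b + 1)) \<in> I_gen"
        using generators_in_I_gen that unfolding cubic_def by blast
      from van[OF this] show ?thesis
        unfolding poly_eval_mult poly_eval_add poly_eval_diff poly_eval_1 cubic_zero_iff .
    qed
    have T78: "y $ 7 = y $ 8" using T by (simp add: T_space_def)
    have pm: "y $ 7 + y $ i \<in> {-1, 0, 1} \<and> y $ 7 - y $ i \<in> {-1, 0, 1}" if "i \<noteq> 7" "i \<noteq> 8" for i
      using u[of "axis 7 1 + axis i 1"] u[of "axis 7 1 + axis i (-1)"]
        axis_pair_generator[OF that, of 1] axis_pair_generator[OF that, of "-1"]
      by (simp add: lin_axis_pair)
    have "(\<exists>a. y = complexify a \<and> (\<forall>i. a $ i \<in> {-1, 0, 1}))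
        \<or> (\<exists>a. y = complexify a \<and> (\<forall>i. a $ i \<in> {1/2, -1/2}))"
      by (rule integral_half_integral_real[OF T78]) (use pm in blast)+
    then show "y \<in> complexify ` E7"
    proof (elim disjE exE conjE)
      fix a assume a: "y = complexify a" "\<forall>i. a $ i \<in> {-1, 0, 1}"
      have "complex_of_real (a \<bullet> a) = 2"
        using nm by (simp add: a(1) inner_vec_def power2_eq_square)
      then have "a \<bullet> a = 2" by (metis of_real_eq_iff of_real_numeral)
      then have "a \<in> E8" using a(2) by (intro integral_root) auto
      then show ?thesis using a(1) T78 by (auto simp: E7_def)
    next
      fix a assume a: "y = complexify a" "\<forall>i. a $ i \<in> {1/2, -1/2}"
      have T': "a $ 7 = a $ 8" using a(1) T78 by simp
      have "a \<in> E8"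
      proof (rule half_integral_root[OF _ T'])
        fix b assume "b \<in> E8" "b $ 7 - b $ 8 = 1"
        then have "complex_of_real (b \<bullet> a) \<in> {-1, 0, 1}"
          using u[of b] by (simp only: a(1) poly_eval_lin_complexify)
        then have "complex_of_real (b \<bullet> a) \<in> {complex_of_real (-1), complex_of_real 0, complex_of_real 1}"
          by simp
        then show "b \<bullet> a \<in> {-1, 0, 1}" by (simp only: insert_iff empty_iff of_real_eq_iff)
      qed (use a(2) in blast)
      then show ?thesis using a(1) T' by (auto simp: E7_def)
    qed
  qed
qed

section \<open>The ideal is the full vanishing ideal\<close>

lemma finite_E8: "finite E8"
proof -
  let ?S = "{-1, -1/2, 0, 1/2, 1 :: real}"
  have "v $ i \<in> ?S" if "v \<in> E8" for v i
    using that unfolding E8_def by (auto simp: axis_nth split: if_splits)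
  then have mem: "vec_nth v \<in> (\<Pi>\<^sub>E i\<in>UNIV. ?S)" if "v \<in> E8" for v
    using that by (simp only: PiE_UNIV_domain Pi_iff) blast
  have "E8 \<subseteq> vec_lambda ` (\<Pi>\<^sub>E i\<in>UNIV. ?S)"
    using imageI[OF mem, of _ vec_lambda] by auto
  then show ?thesis by (rule finite_subset) (simp add: finite_PiE)
qed

lemma double_sum_diff:
  fixes v w a b k s :: "'a::comm_ring_1"
  shows "2 * k = a + b \<Longrightarrow> (v + w - a) * s + (v - w - b) * s = 2 * ((v - k) * s)"
    and "2 * k = a - b \<Longrightarrow> (v + w - a) * s - (v - w - b) * s = 2 * ((w - k) * s)"
proof -
  have "(v + w - a) * s + (v - w - b) * s = (2 * v - (a + b)) * s"
    and "(v + w - a) * s - (v - w - b) * s = (2 * w - (a - b)) * s"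
    by (simp_all add: algebra_simps)
  then show "2 * k = a + b \<Longrightarrow> (v + w - a) * s + (v - w - b) * s = 2 * ((v - k) * s)"
    and "2 * k = a - b \<Longrightarrow> (v + w - a) * s - (v - w - b) * s = 2 * ((w - k) * s)"
    by (simp_all add: left_diff_distrib right_diff_distrib flip: mult.assoc)
qed

text \<open>For \<open>q\<close> vanishing on the roots, the set of all \<open>s\<close> with \<open>q * s\<close> in the ideal contains every joint
eigenvector \<open>s\<close> of the forms \<open>lin b\<close>. Indeed such an \<open>s\<close> is an eigenvector of all coordinates and hence
belongs to a point \<open>y\<close> of the hyperplane, and a polynomial \<open>p\<close> acts on \<open>s\<close> as \<open>p(y)\<close>. If \<open>y\<close> is a root,
\<open>q * s\<close> is \<open>q(y) * s = 0\<close> modulo the ideal. If not, some \<open>h\<close> in the ideal has \<open>h(y) \<noteq> 0\<close>, and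
\<open>h(y) * s\<close> is congruent to \<open>h * s\<close>, which is in the ideal; so \<open>s\<close> itself is.\<close>

lemma vanishing_subset_I_gen: "vanishing_ideal (complexify ` E7) \<subseteq> I_gen"
proof
  fix f assume f: "f \<in> vanishing_ideal (complexify ` E7)"
  then obtain q where q: "f = restr q" by (auto simp: vanishing_ideal_def carrier_R_T)
  have van: "poly_eval y q = 0" if "y \<in> complexify ` E7" for y
    using f that unfolding q vanishing_ideal_restr[OF complexify_E7_T] by blast
  note K = ideal_I_gen
  note add = ideal_restr_add[OF K] and mult = ideal_restr_mult[OF K] and diff = ideal_restr_diff[OF K]
  have "1 \<in> {s. restr (q * s) \<in> I_gen}"
  proof (rule joint_eigenvectors_generate_unit[where J = "{s. restr s \<in> I_gen}" and B = "generator_roots"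
        and u = lin and half = "Const (1/2)"])
    show "finite generator_roots" using finite_E8 by simp
    show "Const (1/2) * 2 = 1" by (rule Const_half)
    fix x y assume "x \<in> {s. restr (q * s) \<in> I_gen}" "y \<in> {s. restr (q * s) \<in> I_gen}"
    then show "x + y \<in> {s. restr (q * s) \<in> I_gen}" by (simp add: distrib_left add)
  next
    fix b assume "b \<in> generator_roots"
    then show "(lin b - 1) * lin b * (lin b + 1) \<in> {s. restr s \<in> I_gen}"
      using generators_in_I_gen by (auto simp: cubic_def)
  next
    fix s :: poly8 and g :: "real^8 \<Rightarrow> int"
    assume eig: "\<And>b. b \<in> generator_roots \<Longrightarrow>
      g b \<in> {-1, 0, 1} \<and> (lin b - of_int (g b)) * s \<in> {s. restr s \<in> I_gen}"
    \<comment> \<open>The eigenvalues of \<open>Var 7 + Var i\<close> and \<open>Var 7 - Var i\<close> are known; half their sum and half their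
      difference are those of \<open>Var 7\<close> and \<open>Var i\<close>. For \<open>Var 7\<close> any \<open>i\<close> serves, here \<open>i = 1\<close>.\<close>
    define y :: "complex^8" where "y = (\<chi> i. if i = 7 \<or> i = 8
       then of_int (g (axis 7 1 + axis 1 1) + g (axis 7 1 + axis 1 (-1))) / 2
       else of_int (g (axis 7 1 + axis i 1) - g (axis 7 1 + axis i (-1))) / 2)"
    have lp: "restr ((Var 7 + Var i - Const (of_int (g (axis 7 1 + axis i 1)))) * s) \<in> I_gen"
     and lm: "restr ((Var 7 - Var i - Const (of_int (g (axis 7 1 + axis i (-1))))) * s) \<in> I_gen"
      if "i \<noteq> 7" "i \<noteq> 8" for i
      using eig[of "axis 7 1 + axis i 1"] eig[of "axis 7 1 + axis i (-1)"]
        axis_pair_generator[OF that, of 1] axis_pair_generator[OF that, of "-1"]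
      by (simp_all add: lin_axis_pair Const_of_int Const_1 Const_minus)
    have halve: "restr p \<in> I_gen" if "restr (2 * p) \<in> I_gen" for p
      using mult[OF that, of "Const (1/2)"] by (simp add: mult.assoc[symmetric] Const_half)
    have two: "2 * Const (c / 2) = Const c" for c
      using Const_hom(3)[of 2 "c/2"] by (simp add: Const_numeral)
    have c7: "restr ((Var 7 - Const (y $ 7)) * s) \<in> I_gen"
    proof -
      have "(1::8) \<noteq> 7" "(1::8) \<noteq> 8" by simp_all
      note add[OF lp[OF this] lm[OF this]]
      also have "(Var 7 + Var 1 - Const (of_int (g (axis 7 1 + axis 1 1)))) * s
         + (Var 7 - Var 1 - Const (of_int (g (axis 7 1 + axis 1 (-1))))) * s
        = 2 * ((Var 7 - Const (y $ 7)) * s)"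
        by (rule double_sum_diff(1)) (simp add: y_def two Const_hom(2))
      finally show ?thesis by (rule halve)
    qed
    have "restr ((Var i - Const (y $ i)) * s) \<in> I_gen" for i
    proof -
      consider "i = 7" | "i = 8" | "i \<noteq> 7" "i \<noteq> 8" by blast
      then show ?thesis
      proof cases
        case 1 then show ?thesis using c7 by simp
      next
        case 2
        have "restr ((Var 8 - Const (y $ 7)) * s) = restr ((Var 7 - Const (y $ 7)) * s)"
          unfolding diff_conv_add_uminus restr_mult restr_add restr_Var_8 ..
        moreover have "y $ 8 = y $ 7" by (simp add: y_def)
        ultimately show ?thesis using c7 2 by simp
      next
        case 3
        note diff[OF lp[OF this] lm[OF this]]
        also have "(Var 7 + Var i - Const (of_int (g (axis 7 1 + axis i 1)))) * s
           - (Var 7 - Var i - Const (of_int (g (axis 7 1 + axis i (-1))))) * s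
          = 2 * ((Var i - Const (y $ i)) * s)"
          using 3 by (intro double_sum_diff(2)) (simp add: y_def two Const_diff)
        finally show ?thesis by (rule halve)
      qed
    qed
    then have ev: "restr ((p - Const (poly_eval y p)) * s) \<in> I_gen" for p
      by (rule eigen_evaluation[OF K])
    show "s \<in> {s. restr (q * s) \<in> I_gen}"
    proof (cases "y \<in> zero_set I_gen")
      case True
      then show ?thesis using ev[of q] van[of y] by (simp add: zero_set_I_gen Const_hom)
    next
      case False
      have T: "y \<in> T_space" by (simp add: T_space_def y_def)
      obtain h where h: "restr h \<in> I_gen" "poly_eval y h \<noteq> 0"
      proof -
        obtain f where f: "f \<in> I_gen" "value_at f y \<noteq> 0" using False T by (auto simp: zero_set_def)
        then obtain h where "f = restr h"
          using I_gen_subset by (auto simp: vanishing_ideal_def carrier_R_T)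
        then show ?thesis using f T that[of h] by (simp add: value_restr)
      qed
      have "s * h - (h - Const (poly_eval y h)) * s = Const (poly_eval y h) * s"
        by (simp add: algebra_simps)
      then have "restr (Const (poly_eval y h) * s) \<in> I_gen"
        using diff[OF mult[OF h(1), of s] ev[of h]] by simp
      from mult[OF this, of "q * Const (1 / poly_eval y h)"]
      have "restr (q * (Const (1 / poly_eval y h) * Const (poly_eval y h)) * s) \<in> I_gen"
        by (simp only: mult_ac)
      then show ?thesis using h(2) by (simp add: Const_hom(3)[symmetric] Const_1)
    qed
  qed (simp_all add: mult)
  then show "f \<in> I_gen" by (simp add: q)
qed


section \<open>Degrees\<close>

definition monom_deg :: "(8 \<Rightarrow>\<^sub>0 nat) \<Rightarrow> nat" where
  "monom_deg m = (\<Sum>i\<in>UNIV. Poly_Mapping.lookup m i)"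

lemma total_degree_le_iff:
  "total_degree p \<le> d \<longleftrightarrow> (\<forall>m\<in>Poly_Mapping.keys p. monom_deg m \<le> d)"
  unfolding total_degree_def monom_deg_def by (subst Max_le_iff) auto

lemma total_degree_add:
  assumes "total_degree p \<le> d" "total_degree q \<le> d"
  shows "total_degree (p + q) \<le> d"
  using assms keys_add[of p q] unfolding total_degree_le_iff by blast

lemma total_degree_mult:
  assumes "total_degree p \<le> d" "total_degree q \<le> e"
  shows "total_degree (p * q) \<le> d + e"
  unfolding total_degree_le_iff
proof
  fix m assume "m \<in> Poly_Mapping.keys (p * q)"
  then obtain k l where "m = k + l" "k \<in> Poly_Mapping.keys p" "l \<in> Poly_Mapping.keys q"
    using keys_mult[of p q] by blast
  then have "monom_deg k \<le> d" "monom_deg l \<le> e" "monom_deg m = monom_deg k + monom_deg l"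
    using assms by (auto simp: total_degree_le_iff monom_deg_def lookup_add sum.distrib)
  then show "monom_deg m \<le> d + e" by simp
qed

lemma total_degree_sum:
  "(\<And>i. i \<in> A \<Longrightarrow> total_degree (f i) \<le> d) \<Longrightarrow> total_degree (sum f A) \<le> d"
proof (induction A rule: infinite_finite_induct)
  case (insert x F)
  then show ?case by (simp add: total_degree_add)
qed (simp_all add: total_degree_def)

lemma total_degree_Const: "total_degree (Const c) = 0"
  by (simp add: total_degree_def Const_def)

lemma total_degree_Var: "total_degree (Var i) \<le> 1"
  by (simp add: total_degree_le_iff Var_def monom_deg_def lookup_single when_def)

lemma subst_sum: "subst_Y8_Y7 (sum f A) = (\<Sum>i\<in>A. subst_Y8_Y7 (f i))"
  unfolding subst_Y8_Y7_def by (rule poly_subst_sum) (simp_all add: Const_hom)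

lemma degree_subst_lin: "total_degree (subst_Y8_Y7 (lin b + Const c)) \<le> 1"
proof -
  have "total_degree (Const (complex_of_real (b $ i)) * subst_Y8_Y7 (Var i)) \<le> 0 + 1" for i
    by (rule total_degree_mult) (simp_all add: total_degree_Const subst_Y8_Y7_Var total_degree_Var[simplified])
  then have "total_degree (\<Sum>i\<in>UNIV. Const (complex_of_real (b $ i)) * subst_Y8_Y7 (Var i)) \<le> 1"
    by (intro total_degree_sum) simp
  then show ?thesis
    by (simp add: lin_def subst_Y8_Y7_add subst_sum subst_Y8_Y7_mult subst_Const
        total_degree_add total_degree_Const)
qed

lemma degree_cubic: "degree_T (cubic b) \<le> 3"
proof -
  have eq: "(lin b - 1) * lin b * (lin b + 1)
      = (lin b + Const (-1)) * (lin b + Const 0) * (lin b + Const 1)"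
    by (simp add: Const_minus Const_1 Const_hom)
  have "total_degree (subst_Y8_Y7 ((lin b - 1) * lin b * (lin b + 1))) \<le> (1 + 1) + 1"
    unfolding eq subst_Y8_Y7_mult by (intro total_degree_mult degree_subst_lin)
  then show ?thesis by (simp add: cubic_def degree_restr)
qed

lemma degree_Nm: "degree_T Nm \<le> 2"
proof -
  have eq: "norm_poly = (\<Sum>i\<in>UNIV. Var i * Var i) + Const (-2)"
    by (simp add: Const_minus Const_numeral power2_eq_square)
  have "total_degree (subst_Y8_Y7 (Var i)) \<le> 1" for i
    by (simp add: subst_Y8_Y7_Var total_degree_Var[simplified])
  then have "total_degree (subst_Y8_Y7 (Var i) * subst_Y8_Y7 (Var i)) \<le> 1 + 1" for i
    by (intro total_degree_mult)
  then have "total_degree (subst_Y8_Y7 norm_poly) \<le> 1 + 1"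
    unfolding eq subst_Y8_Y7_add subst_sum subst_Y8_Y7_mult subst_Const
    by (intro total_degree_add total_degree_sum) (auto simp: total_degree_Const)
  then show ?thesis by (simp add: Nm_def degree_restr)
qed


section \<open>Polynomials of degree at most two\<close>

definition quadric :: "complex \<Rightarrow> (8 \<Rightarrow> complex) \<Rightarrow> (8 \<Rightarrow> 8 \<Rightarrow> complex) \<Rightarrow> poly8" where
  "quadric a b c = Const a + (\<Sum>i\<in>UNIV. Const (b i) * Var i)
     + (\<Sum>i\<in>UNIV. \<Sum>j\<in>UNIV. Const (c i j) * Var i * Var j)"

text \<open>A normal form on the hyperplane: the eighth variable is eliminated, and the quadratic part has a
symmetric coefficient matrix.\<close>

definition reduced_coeffs :: "(8 \<Rightarrow> complex) \<Rightarrow> (8 \<Rightarrow> 8 \<Rightarrow> complex) \<Rightarrow> bool" where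
  "reduced_coeffs b c \<longleftrightarrow> b 8 = 0 \<and> (\<forall>i. c i 8 = 0) \<and> (\<forall>i j. c i j = c j i)"

lemma quadric_add:
  "quadric a b c + quadric a' b' c' = quadric (a + a') (\<lambda>i. b i + b' i) (\<lambda>i j. c i j + c' i j)"
  by (simp add: quadric_def Const_hom sum.distrib algebra_simps)

definition is_quadric :: "poly8 \<Rightarrow> bool" where
  "is_quadric p \<longleftrightarrow> (\<exists>a b c. reduced_coeffs b c \<and> restr p = restr (quadric a b c))"

lemma is_quadric_add:
  assumes "is_quadric p" "is_quadric q"
  shows "is_quadric (p + q)"
proof -
  obtain a b c a' b' c' where "reduced_coeffs b c" "restr p = restr (quadric a b c)"
    "reduced_coeffs b' c'" "restr q = restr (quadric a' b' c')"
    using assms unfolding is_quadric_def by blast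
  then have "reduced_coeffs (\<lambda>i. b i + b' i) (\<lambda>i j. c i j + c' i j)"
    "restr (p + q) = restr (quadric (a + a') (\<lambda>i. b i + b' i) (\<lambda>i j. c i j + c' i j))"
    by (auto simp: reduced_coeffs_def restr_add quadric_add[symmetric])
  then show ?thesis unfolding is_quadric_def by blast
qed

lemma is_quadric_Const: "is_quadric (Const a)"
  unfolding is_quadric_def
  by (rule exI[of _ a], rule exI[of _ "\<lambda>_. 0"], rule exI[of _ "\<lambda>_ _. 0"])
    (simp add: reduced_coeffs_def quadric_def Const_hom)

lemma is_quadric_sum: "(\<And>i. i \<in> A \<Longrightarrow> is_quadric (f i)) \<Longrightarrow> is_quadric (sum f A)"
proof (induction A rule: infinite_finite_induct)
  case (insert x F)
  then show ?case by (simp add: is_quadric_add)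
qed (use is_quadric_Const[of 0] in \<open>simp_all add: Const_hom\<close>)

lemma restr_Var_cases: obtains k where "k \<noteq> 8" "restr (Var i) = restr (Var k)"
proof (cases "i = 8")
  case True
  then show ?thesis using that[of 7] restr_Var_8 by simp
qed (use that in blast)

lemma is_quadric_linear: "is_quadric (Const d * Var i)"
proof -
  obtain k where k: "k \<noteq> 8" "restr (Var i) = restr (Var k)" by (rule restr_Var_cases)
  have "quadric 0 (\<lambda>l. if l = k then d else 0) (\<lambda>_ _. 0) = Const d * Var k"
  proof -
    have "(\<Sum>l\<in>UNIV. Const (if l = k then d else 0) * Var l) = (\<Sum>l\<in>UNIV. if l = k then Const d * Var k else 0)"
      by (rule sum.cong) (auto simp: Const_hom)
    then show ?thesis by (simp add: quadric_def Const_hom)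
  qed
  moreover have "restr (Const d * Var i) = restr (Const d * Var k)" using k(2) by (simp add: restr_mult)
  moreover have "reduced_coeffs (\<lambda>l. if l = k then d else 0) (\<lambda>_ _. 0)" using k(1) by (simp add: reduced_coeffs_def)
  ultimately show ?thesis unfolding is_quadric_def by metis
qed

lemma is_quadric_product: "is_quadric (Const d * Var i * Var j)"
proof -
  obtain k where k: "k \<noteq> 8" "restr (Var i) = restr (Var k)" by (rule restr_Var_cases)
  obtain l where l: "l \<noteq> 8" "restr (Var j) = restr (Var l)" by (rule restr_Var_cases)
  \<comment> \<open>For a symmetric matrix the coefficient is shared equally by \<open>(k, l)\<close> and \<open>(l, k)\<close>; for \<open>k = l\<close> the two
    halves add up in one entry.\<close>
  define c where "c m n = (if m = k then if n = l then d / 2 else 0 else 0)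
     + (if m = l then if n = k then d / 2 else 0 else 0)" for m n
  have "reduced_coeffs (\<lambda>_. 0) c" using k(1) l(1) by (auto simp: reduced_coeffs_def c_def)
  moreover have "quadric 0 (\<lambda>_. 0) c = Const d * Var k * Var l"
  proof -
    have "(\<Sum>m\<in>UNIV. \<Sum>n\<in>UNIV. Const (c m n) * Var m * Var n)
      = (\<Sum>m\<in>UNIV. if m = k then Const (d/2) * Var k * Var l else 0)
        + (\<Sum>m\<in>UNIV. if m = l then Const (d/2) * Var l * Var k else 0)"
      unfolding sum.distrib[symmetric]
    proof (rule sum.cong)
      fix m
      have "(\<Sum>n\<in>UNIV. Const (c m n) * Var m * Var n)
        = (\<Sum>n\<in>UNIV. (if n = l then if m = k then Const (d/2) * Var k * Var l else 0 else 0)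
           + (if n = k then if m = l then Const (d/2) * Var l * Var k else 0 else 0))"
        by (rule sum.cong) (auto simp: c_def Const_hom algebra_simps)
      then show "(\<Sum>n\<in>UNIV. Const (c m n) * Var m * Var n)
         = (if m = k then Const (d/2) * Var k * Var l else 0) + (if m = l then Const (d/2) * Var l * Var k else 0)"
        by (simp add: sum.distrib)
    qed simp
    also have "\<dots> = (Const (d/2) + Const (d/2)) * Var k * Var l"
      by (simp add: algebra_simps)
    also have "Const (d/2) + Const (d/2) = Const d" by (simp flip: Const_hom(2))
    finally show ?thesis by (simp add: quadric_def Const_hom)
  qed
  moreover have "restr (Const d * Var i * Var j) = restr (Const d * Var k * Var l)"
    using k(2) l(2) by (simp add: restr_mult)
  ultimately show ?thesis unfolding is_quadric_def by metis
qed

lemma monomial_Suc: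
  assumes "monom_deg m = Suc d"
  obtains i m' where "monom_deg m' = d"
    "\<And>c. (Poly_Mapping.single m c :: poly8) = Poly_Mapping.single m' c * Var i"
proof -
  obtain i where i: "Poly_Mapping.lookup m i \<noteq> 0"
    using assms unfolding monom_deg_def by (metis sum.neutral nat.distinct(1))
  define m' where "m' = m - Poly_Mapping.single i 1"
  have m: "m = m' + Poly_Mapping.single i 1"
    unfolding m'_def using i
    by (intro poly_mapping_eqI) (auto simp: lookup_add lookup_minus lookup_single when_def)
  then have "monom_deg m = monom_deg m' + 1"
    by (simp add: monom_deg_def lookup_add sum.distrib lookup_single when_def)
  then have "monom_deg m' = d" using assms by simp
  then show ?thesis using that[of m' i] by (simp add: m Var_def mult_single)
qed

lemma monom_deg_0: "monom_deg m = 0 \<Longrightarrow> m = 0"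
  by (intro poly_mapping_eqI) (simp add: monom_deg_def)

text \<open>Every monomial of degree at most two is a constant, or a constant times one or two variables, and
each of these has a normal form on the hyperplane.\<close>

lemma is_quadric_if_degree_le_2:
  assumes "total_degree p \<le> 2"
  shows "is_quadric p"
proof -
  have mono: "is_quadric (Poly_Mapping.single m c)" if "monom_deg m \<le> 2" for m c
  proof -
    consider "monom_deg m = 0" | "monom_deg m = Suc 0" | "monom_deg m = Suc (Suc 0)" using \<open>monom_deg m \<le> 2\<close> by linarith
    then show ?thesis
    proof cases
      case 1
      show ?thesis using is_quadric_Const[of c] unfolding monom_deg_0[OF 1] Const_def .
    next
      case 2
      then obtain i m' where "monom_deg m' = 0" "\<And>c. (Poly_Mapping.single m c :: poly8) = Poly_Mapping.single m' c * Var i"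
        using monomial_Suc by blast
      then show ?thesis using is_quadric_linear[of c i] by (auto dest!: monom_deg_0 simp: Const_def)
    next
      case 3
      then obtain i m' where 1: "monom_deg m' = Suc 0" "\<And>c. (Poly_Mapping.single m c :: poly8) = Poly_Mapping.single m' c * Var i"
        using monomial_Suc by blast
      then obtain j m'' where "monom_deg m'' = 0" "\<And>c. (Poly_Mapping.single m' c :: poly8) = Poly_Mapping.single m'' c * Var j"
        using monomial_Suc by blast
      then show ?thesis using is_quadric_product[of c j i] 1 by (auto dest!: monom_deg_0 simp: Const_def)
    qed
  qed
  have "is_quadric (\<Sum>m\<in>Poly_Mapping.keys p. Poly_Mapping.single m (Poly_Mapping.lookup p m))"
    using assms by (intro is_quadric_sum mono) (auto simp: total_degree_le_iff)
  then show ?thesis by (subst poly8_expansion)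
qed


section \<open>Quadrics through the roots\<close>

lemma axis_pair_E7:
  assumes "i \<noteq> j" "i \<notin> {7, 8}" "j \<notin> {7, 8}" "s \<in> {1, -1}" "t \<in> {1, -1}"
  shows "axis i s + axis j t \<in> E7"
  using axis_E8[of i j s t] assms by (auto simp: E7_def axis_nth)

lemma axis_78_E7: "s \<in> {1, -1} \<Longrightarrow> axis 7 s + axis 8 s \<in> E7"
  using axis_E8[of 7 8 s s] by (auto simp: E7_def axis_nth)

lemma half_E7:
  assumes "i \<noteq> j" "i \<notin> {7, 8}" "j \<notin> {7, 8}"
  shows "(\<chi> k. if k = i \<or> k = j then - 1/2 else 1/2) \<in> E7"
proof -
  let ?v = "(\<chi> k. if k = i \<or> k = j then - 1/2 else 1/2) :: real^8"
  have "{k. ?v $ k < 0} = {i, j}" by auto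
  then have "even (card {k. ?v $ k < 0})" using assms(1) by simp
  then have "?v \<in> E8" unfolding E8_def by auto
  then show ?thesis using assms by (auto simp: E7_def)
qed

lemma all_half_E7: "(\<chi> k. 1/2) \<in> E7"
  by (auto simp: E7_def E8_def)

lemma third_indices:
  obtains j k :: 8 where "j \<noteq> i" "k \<noteq> i" "j \<noteq> k" "j \<notin> {7, 8}" "k \<notin> {7, 8}"
proof -
  consider "i = 1" | "i = 2" | "i \<noteq> 1" "i \<noteq> 2" by blast
  then show ?thesis
    by cases (use that[of 2 3] that[of 1 3] that[of 1 2] in simp_all)
qed

lemma sum_pair:
  fixes g :: "8 \<Rightarrow> complex"
  shows "(\<Sum>k\<in>UNIV. g k * complexify (axis i s + axis j t) $ k) = g i * of_real s + g j * of_real t"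
proof -
  have "g k * complexify (axis i s + axis j t) $ k = (if k = i then g k * of_real s else 0) + (if k = j then g k * of_real t else 0)" for k
    by (auto simp: axis_nth algebra_simps)
  then show ?thesis by (simp add: sum.distrib)
qed

lemma poly_eval_quadric:
  "poly_eval y (quadric a b c) = a + (\<Sum>i\<in>UNIV. b i * y $ i) + (\<Sum>i\<in>UNIV. (\<Sum>j\<in>UNIV. c i j * y $ j) * y $ i)"
  by (simp add: quadric_def sum_distrib_right sum_distrib_left mult_ac)

text \<open>The vanishing at sufficiently many roots determines all coefficients up to a common factor. Away
from the last two indices, the four roots with entries \<open>1\<close> or \<open>-1\<close> at \<open>i\<close> and \<open>j\<close> give \<open>c i j = 0\<close>,
\<open>c i i + c j j = - a\<close> and \<open>b i \<plusminus> b j = 0\<close>; a third index then gives \<open>c i i = - a / 2\<close> and \<open>b i = 0\<close>. The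
two roots supported at \<open>7\<close> and \<open>8\<close> give \<open>b 7 = 0\<close> and \<open>c 7 7 = - a\<close>, where the double value reflects
that the seventh coordinate stands for two equal ones. What is left are the mixed terms
\<open>c i 7\<close>; they are killed by the half-integral roots.\<close>

lemma quadric_through_E7:
  assumes red: "reduced_coeffs b c"
    and van: "\<And>r. r \<in> E7 \<Longrightarrow> poly_eval (complexify r) (quadric a b c) = 0"
  shows "restr (quadric a b c) = restr (Const (- a / 2) * norm_poly)"
proof -
  have b8: "b 8 = 0" and c8: "c i 8 = 0" "c 8 i = 0" and sym: "c i j = c j i" for i j
    using red by (auto simp: reduced_coeffs_def)
  have pair: "a + (b i * of_real s + b j * of_real t) +
     ((c i i * of_real s + c i j * of_real t) * of_real s + (c j i * of_real s + c j j * of_real t) * of_real t) = 0"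
    if "axis i s + axis j t \<in> E7" for i j s t
    using van[OF that] unfolding poly_eval_quadric sum_pair .
  have pairs: "b i + b j = 0" "b i - b j = 0" "a + c i i + c j j = 0" "c i j = 0"
    if ij: "i \<noteq> j" "i \<notin> {7, 8}" "j \<notin> {7, 8}" for i j
  proof -
    define e where "e s t = a + (b i * s + b j * t)
      + ((c i i * s + c i j * t) * s + (c i j * s + c j j * t) * t)" for s t
    have e: "e 1 1 = 0" "e 1 (-1) = 0" "e (-1) 1 = 0" "e (-1) (-1) = 0"
      using pair[OF axis_pair_E7[OF ij, of 1 1]] pair[OF axis_pair_E7[OF ij, of 1 "-1"]]
        pair[OF axis_pair_E7[OF ij, of "-1" 1]] pair[OF axis_pair_E7[OF ij, of "-1" "-1"]]
      by (simp_all add: e_def sym[of j i])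
    have "b i + b j = (e 1 1 - e (-1) (-1)) / 2" by (simp add: e_def field_simps)
    then show "b i + b j = 0" unfolding e by simp
    have "b i - b j = (e 1 (-1) - e (-1) 1) / 2" by (simp add: e_def field_simps)
    then show "b i - b j = 0" unfolding e by simp
    have "c i j = (e 1 1 + e (-1) (-1) - e 1 (-1) - e (-1) 1) / 8"
      by (simp add: e_def field_simps)
    then show "c i j = 0" unfolding e by simp
    have "a + c i i + c j j = (e 1 1 + e (-1) (-1) + e 1 (-1) + e (-1) 1) / 4"
      by (simp add: e_def field_simps)
    then show "a + c i i + c j j = 0" unfolding e by simp
  qed
  have bi: "b i = 0" and cii: "c i i = - a / 2" if "i \<notin> {7, 8}" for i
  proof -
    obtain j k :: 8 where jk: "j \<noteq> i" "k \<noteq> i" "j \<noteq> k" "j \<notin> {7, 8}" "k \<notin> {7, 8}" by (rule third_indices)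
    have "b i = ((b i + b j) + (b i - b j)) / 2" by simp
    also have "\<dots> = 0" unfolding pairs(1,2)[OF jk(1)[symmetric] that jk(4)] by simp
    finally show "b i = 0" .
    have "c i i = ((a + c i i + c j j) + (a + c i i + c k k) - (a + c j j + c k k) - a) / 2"
      by (simp add: field_simps)
    also have "\<dots> = - a / 2"
      unfolding pairs(3)[OF jk(1)[symmetric] that jk(4)] pairs(3)[OF jk(2)[symmetric] that jk(5)]
        pairs(3)[OF jk(3) jk(4,5)] by simp
    finally show "c i i = - a / 2" .
  qed
  have b7: "b 7 = 0" and c77: "c 7 7 = - a"
  proof -
    have p: "a + b 7 + c 7 7 = 0" and m: "a - b 7 + c 7 7 = 0"
      using pair[OF axis_78_E7[of 1]] pair[OF axis_78_E7[of "-1"]] by (simp_all add: b8 c8)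
    have "b 7 = ((a + b 7 + c 7 7) - (a - b 7 + c 7 7)) / 2" by (simp add: field_simps)
    then show "b 7 = 0" unfolding p m by simp
    then show "c 7 7 = - a" using p by (simp add: eq_neg_iff_add_eq_0 add.commute)
  qed
  have b0: "b i = 0" for i using bi[of i] b7 b8 by (cases "i \<in> {7, 8}") auto
  \<comment> \<open>At a half-integral root the square terms contribute exactly \<open>- a\<close>, which cancels the constant
    term, so the mixed terms add up to zero.\<close>
  define g where "g k = (if k \<in> {7, 8} then 0 else c k 7)" for k
  have half: "(\<Sum>k\<in>UNIV. g k * complexify v $ k) = 0"
    if v: "v \<in> E7" "v $ 7 = 1/2" "\<And>k. v $ k \<in> {1/2, -1/2}" for v
  proof -
    let ?y = "\<lambda>k. complex_of_real (v $ k)"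
    have sq: "?y k * ?y k = 1/4" for k
    proof -
      have "?y k * ?y k = complex_of_real (v $ k * v $ k)" by simp
      then show ?thesis unfolding half_square[OF v(3)] by simp
    qed
    have y7: "?y 7 = 1/2" unfolding v(2) by simp
    have "0 = a + (\<Sum>i\<in>UNIV. (\<Sum>j\<in>UNIV. c i j * ?y j) * ?y i)"
      using van[OF v(1)] by (simp add: poly_eval_quadric b0)
    also have "\<dots> = (\<Sum>k\<in>UNIV. g k * complexify v $ k)"
    proof -
      have row: "(\<Sum>j\<in>UNIV. c i j * ?y j) * ?y i = - a / 8 + g i * ?y i / 2" if "i \<notin> {7, 8}" for i
      proof -
        have "c i j * ?y j = (if j = i then - a / 2 * ?y j else 0) + (if j = 7 then g i * ?y j else 0)" for j
          using that pairs(4)[of i j] cii[OF that] c8 by (auto simp: g_def)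
        then have "(\<Sum>j\<in>UNIV. c i j * ?y j) = - a / 2 * ?y i + g i * ?y 7"
          by (simp add: sum.distrib)
        then have "(\<Sum>j\<in>UNIV. c i j * ?y j) * ?y i = - a / 2 * (?y i * ?y i) + g i * ?y 7 * ?y i"
          by (simp only: distrib_right mult.assoc)
        then show ?thesis unfolding sq y7 by simp
      qed
      have "c 7 j * ?y j = (if j = 7 then - a * ?y j else 0) + g j * ?y j" for j
        using c77 c8 sym[of 7 j] by (auto simp: g_def)
      then have row7: "(\<Sum>j\<in>UNIV. c 7 j * ?y j) * ?y 7 = - a / 4 + (\<Sum>j\<in>UNIV. g j * ?y j) / 2"
        by (simp add: sum.distrib y7 distrib_right)
      have row8: "(\<Sum>j\<in>UNIV. c 8 j * ?y j) * ?y 8 = 0" by (simp add: c8)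
      have "(\<Sum>i\<in>UNIV. (\<Sum>j\<in>UNIV. c i j * ?y j) * ?y i)
          = - a + (\<Sum>i\<in>UNIV. g i * ?y i)"
        unfolding sum_8[of "\<lambda>i. (\<Sum>j\<in>UNIV. c i j * ?y j) * ?y i"]
        by (simp add: row row7 row8) (simp add: sum_8 g_def field_simps)
      then show ?thesis by simp
    qed
    finally show ?thesis by simp
  qed
  have g_pair: "g i + g j = 0" if ij: "i \<noteq> j" "i \<notin> {7, 8}" "j \<notin> {7, 8}" for i j
  proof -
    let ?v = "(\<chi> k. if k = i \<or> k = j then - 1/2 else 1/2) :: real^8" and ?h = "(\<chi> k. 1/2) :: real^8"
    have "(\<Sum>k\<in>UNIV. g k * complexify ?h $ k) = 0" "(\<Sum>k\<in>UNIV. g k * complexify ?v $ k) = 0"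
      using ij by (intro half all_half_E7 half_E7[OF ij]; auto)+
    then have "0 = (\<Sum>k\<in>UNIV. g k * complexify ?h $ k - g k * complexify ?v $ k)"
      by (simp only: sum_subtractf diff_self)
    \<comment> \<open>The two half-integral roots differ by the root \<open>axis i 1 + axis j 1\<close>.\<close>
    also have "\<dots> = (\<Sum>k\<in>UNIV. g k * complexify (axis i 1 + axis j 1) $ k)"
      using ij(1) by (intro sum.cong) (auto simp: axis_nth)
    finally show ?thesis by (simp add: sum_pair[of g i 1 j 1, simplified])
  qed
  have ci7: "c i 7 = 0" if "i \<notin> {7, 8}" for i
  proof -
    obtain j k :: 8 where jk: "j \<noteq> i" "k \<noteq> i" "j \<noteq> k" "j \<notin> {7, 8}" "k \<notin> {7, 8}" by (rule third_indices)
    have "g i = ((g i + g j) + (g i + g k) - (g j + g k)) / 2" by simp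
    also have "\<dots> = 0"
      unfolding g_pair[OF jk(1)[symmetric] that jk(4)] g_pair[OF jk(2)[symmetric] that jk(5)]
        g_pair[OF jk(3) jk(4,5)] by simp
    finally have "g i = 0" .
    then show ?thesis using that by (auto simp: g_def)
  qed
  have c7i: "c 7 i = 0" if "i \<notin> {7, 8}" for i using ci7[OF that] sym[of 7 i] by simp
  define K where "K = Const (a / 2)"
  have K: "Const a = K * 2" "Const (- a / 2) = - K" "Const (- a) = - (K * 2)"
    using Const_hom(3)[of "a / 2" 2] by (simp_all add: K_def Const_minus Const_numeral)
  have "quadric a b c = Const (- a / 2) * norm_poly + K * (Var 8 * Var 8 - Var 7 * Var 7)"
    unfolding quadric_def sum_8
    by (simp add: b0 pairs(4) cii c77 c8 ci7 c7i Const_hom(1) K K(2)[simplified] power2_eq_square algebra_simps)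
  moreover have "restr (K * (Var 8 * Var 8 - Var 7 * Var 7)) = restr 0"
  proof -
    have "restr (K * (Var 8 * Var 8 - Var 7 * Var 7)) = restr (K * (Var 7 * Var 7 - Var 7 * Var 7))"
      unfolding diff_conv_add_uminus restr_mult restr_add restr_minus restr_Var_8 ..
    then show ?thesis by simp
  qed
  ultimately show ?thesis by (simp add: restr_add) (simp flip: restr_add)
qed

lemma trivial_restr_multiple: "trivial_elem (restr (Const k * norm_poly))"
  unfolding trivial_elem_def factor_def Nm_def
  by (rule bexI[of _ "restr (Const k)"]) (simp_all add: mult.commute flip: restr_mult)

lemma low_degree_trivial:
  assumes f: "f \<in> vanishing_ideal (complexify ` E7)" and d: "degree_T f \<le> 2"
  shows "trivial_elem f"
proof -
  obtain p where p: "f = restr p" using f by (auto simp: vanishing_ideal_def carrier_R_T)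
  then have "is_quadric (subst_Y8_Y7 p)"
    using d by (intro is_quadric_if_degree_le_2) (simp add: degree_restr)
  then obtain a b c where abc: "reduced_coeffs b c" "f = restr (quadric a b c)"
    unfolding is_quadric_def restr_subst p by blast
  have "poly_eval (complexify r) (quadric a b c) = 0" if "r \<in> E7" for r
    using f that unfolding abc(2) vanishing_ideal_restr[OF complexify_E7_T] by blast
  from quadric_through_E7[OF abc(1) this] show ?thesis
    unfolding abc(2) by (simp only: trivial_restr_multiple)
qed

lemma nontrivial_cubic: "\<not> trivial_elem (cubic (axis 7 1 + axis 1 1))"
proof
  let ?b = "axis 7 1 + axis 1 1 :: real^8"
  assume "trivial_elem (cubic ?b)"
  then obtain h where "cubic ?b = restr (norm_poly * h)"
    by (auto simp: trivial_elem_def factor_def Nm_def carrier_R_T simp flip: restr_mult)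
  then have eq: "restr ((lin ?b - 1) * lin ?b * (lin ?b + 1)) = restr (norm_poly * h)"
    by (simp only: cubic_def)
  \<comment> \<open>A point of squared length \<open>16/9 + 1/9 + 1/9 = 2\<close> at which the linear form takes the value \<open>5/3\<close>,
    so that the cubic does not vanish there.\<close>
  define y :: "complex^8" where "y = (\<chi> i. if i = 7 \<or> i = 8 then 1/3 else if i = 1 then 4/3 else 0)"
  have T: "y \<in> T_space" by (simp add: T_space_def y_def)
  have "poly_eval y ((lin ?b - 1) * lin ?b * (lin ?b + 1)) = poly_eval y (norm_poly * h)"
    using arg_cong[OF eq, of "\<lambda>f. value_at f y"] by (simp only: value_restr[OF T])
  moreover have "poly_eval y norm_poly = 0"
    by (simp add: sum_8 y_def power2_eq_square)
  moreover have "poly_eval y (lin ?b) = 5/3"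
    by (simp add: lin_axis_pair y_def)
  ultimately show False by simp
qed

section \<open>The ideal of the roots\<close>

text \<open>The lower bound on the degree also yields the degree of the chosen cubic: it is non-trivial, so
its degree is at least three.\<close>

theorem theorem3p2:
  shows "zero_set I_gen = complexify ` E7
    \<and> radical_ideal R_T I_gen
    \<and> ((\<exists>f \<in> vanishing_ideal (complexify ` E7). \<not> trivial_elem f \<and> degree_T f = 3) \<and>
       (\<forall>f \<in> vanishing_ideal (complexify ` E7). \<not> trivial_elem f \<longrightarrow> 3 \<le> degree_T f))
    \<and> (\<exists>G \<subseteq> carrier R_T. (\<forall>g\<in>G. degree_T g \<le> 3) \<and>
         vanishing_ideal (complexify ` E7) = Idl\<^bsub>R_T\<^esub> G)"
proof (intro conjI)
  have I: "I_gen = vanishing_ideal (complexify ` E7)"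
    using I_gen_subset vanishing_subset_I_gen by blast
  show "zero_set I_gen = complexify ` E7" by (rule zero_set_I_gen)
  show "radical_ideal R_T I_gen"
    unfolding I by (rule radical_vanishing_ideal[OF complexify_E7_T])
  show ge: "\<forall>f \<in> vanishing_ideal (complexify ` E7). \<not> trivial_elem f \<longrightarrow> 3 \<le> degree_T f"
    using low_degree_trivial by force
  have "axis 7 1 + axis 1 1 \<in> E8 \<and> (axis 7 1 + axis 1 1 :: real^8) $ 7 - (axis 7 1 + axis 1 1 :: real^8) $ 8 = 1"
    by (rule axis_pair_generator) simp_all
  then have "cubic (axis 7 1 + axis 1 1) \<in> vanishing_ideal (complexify ` E7)"
    by (intro generators_vanish) blast
  then show "\<exists>f \<in> vanishing_ideal (complexify ` E7). \<not> trivial_elem f \<and> degree_T f = 3"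
    using nontrivial_cubic ge degree_cubic by (metis le_antisym)
  show "\<exists>G \<subseteq> carrier R_T. (\<forall>g\<in>G. degree_T g \<le> 3) \<and>
         vanishing_ideal (complexify ` E7) = Idl\<^bsub>R_T\<^esub> G"
  proof (intro exI conjI)
    show "generators \<subseteq> carrier R_T"
      by (rule generators_carrier)
    show "\<forall>g\<in>generators. degree_T g \<le> 3"
      using degree_cubic order_trans[OF degree_Nm, of 3] by auto
    show "vanishing_ideal (complexify ` E7) = Idl\<^bsub>R_T\<^esub> generators"
      using I unfolding I_gen_def by simp
  qed
qed

end
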